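(* Let $P$ be a leveled branching program whose nodes carry two-part encodings distinct within each level, apart from at most one outputless empty node per level, computing $\mathrm{Rank}_{n,n^2}$ correctly on every input; for an input $x$ let $t^*(x)$ be the level at which the run on $x$ produces its last output, and let $\mathrm{cm}_P(x)=\sum_t|v_t(x)|$. Then for at least $15/16$ of the inputs $x$ under the uniform distribution $\mu$ on lists of $n$ distinct integers from $[n^2]$, $$t^*(x)=\Omega(n^2/\log^2 n)\quad\text{or}\quad \mathrm{cm}_P(x)=\Omega(n^2/\log n).$$ For a program correct with probability $n^{-c}$ the set of such inputs has probability $>\tfrac{15}{16}n^{-c}$. Sorting $n$ items from $[n^3]$ reduces to ranking with the same node lengths and output levels: a program for $\mathrm{Sort}_{n,n\cdot n^2}$ becomes one for $\mathrm{Rank}_{n,n^2}$, without restructuring, by running it on the input whose $i$-th item is the pair $\langle y_i,i\rangle\in[n^2]\times[n]$. Hence for sorting programs the bound holds on the images of the good ranking inputs: fifteen sixteenths of the lists $(\langle y_i,i\rangle)_i$ with $y$ uniform over lists of $n$ distinct integers from $[n^2]$.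
   Context: Leveled branching program: a leveled directed acyclic multigraph with one root at level $0$, edges going from a level to the next; each node queries at most one input item, out-edges being labeled by its possible contents; an edge may emit output items (position, value), counted at the edge's source level; each output is emitted as one item, once. The run on $x$ follows from the root the edges consistent with $x$; $v_t(x)$ is the node it visits at level $t$. Two-part encoding: each node is encoded by a pair of binary strings; distinct nodes of a level have distinct pairs, apart from at most one designated empty node per level, of length $0$, from which no output is ever produced; the root, alone at its level, is encoded as the empty pair. $|v|$ is the total length of the two strings of $v$. $\mathrm{Rank}_{n,N}$: given a list of $n$ integers from $[N]$, output for each $i$ the rank of the $i$-th integer in the list ($n$ output items). $\mathrm{Sort}_{n,N}$: given a list of $n$ integers from $[N]$, output them in sorted order. $\langle\cdot,\cdot\rangle:[N]\times[n]\to[nN]$ is the order-preserving (lexicographic) pairing. $c\ge0$ is a constant, on which the $\Omega$-constants may depend; correctness with probability $n^{-c}$ is over $\mu$ (and the coins, if any). A known fact (Borodin–Cook; Beame–Kornerup) the result rests on: there is $\alpha>0$ such that for every branching program $B$ of height $\le\alpha n$ and every $k\le 2\alpha n$, $\Pr_{x\sim\mu}[B\text{ produces at least }k\text{ correct outputs of }\mathrm{Rank}_{n,n^2}\text{ on }x]\le 2^{-k/\lceil\log_2 n\rceil}$. *)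

theory Defs
  imports "HOL-Probability.Probability_Mass_Function"
begin

text \<open>
  Lists of \<open>n\<close> integers from \<open>[N] = {1..N}\<close>. Input and output positions are counted from 0,
  contents and ranks from 1.
\<close>

definition inputs :: "nat \<Rightarrow> nat \<Rightarrow> nat list set" where
  "inputs n N = {x. length x = n \<and> set x \<subseteq> {1..N}}"

text \<open>An output item is a pair (position, value).\<close>

type_synonym item = "nat \<times> nat"

text \<open>
  Nodes are named by natural numbers, so that the constants hidden in asymptotic statements cannot
  depend on a type of nodes. \<open>out_edge P v (Some a)\<close> is the out-edge of \<open>v\<close> labeled by the
  content \<open>a\<close>, and \<open>out_edge P v None\<close> the single unlabeled out-edge that a node without query may
  have; an edge is given by its target and the items it emits. Edges are identified by their source
  and label, so several of them may join the same two nodes. A node without out-edge is a sink.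
  \<open>blank P\<close> is the set of designated empty nodes.
\<close>

record bprog =
  nodes :: "nat set"
  level :: "nat \<Rightarrow> nat"
  start :: nat
  query :: "nat \<Rightarrow> nat option"
  out_edge :: "nat \<Rightarrow> nat option \<Rightarrow> (nat \<times> item list) option"
  enc :: "nat \<Rightarrow> bool list \<times> bool list"
  blank :: "nat set"

definition leveled_bp :: "nat \<Rightarrow> nat \<Rightarrow> bprog \<Rightarrow> bool" where
  "leveled_bp n N P \<longleftrightarrow>
     finite (nodes P) \<and>
     start P \<in> nodes P \<and>
     (\<forall>v\<in>nodes P. level P v = 0 \<longleftrightarrow> v = start P) \<and>
     (\<forall>v\<in>nodes P. case query P v of
         Some i \<Rightarrow> i < n \<and> out_edge P v None = None \<and>
                   (\<forall>a. out_edge P v (Some a) \<noteq> None \<longleftrightarrow> a \<in> {1..N})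
       | None \<Rightarrow> (\<forall>a. out_edge P v (Some a) = None)) \<and>
     (\<forall>v\<in>nodes P. \<forall>l w os. out_edge P v l = Some (w, os) \<longrightarrow>
         w \<in> nodes P \<and> level P w = Suc (level P v))"

definition height :: "bprog \<Rightarrow> nat" where
  "height P = Max (level P ` nodes P)"

definition consistent_edge :: "bprog \<Rightarrow> nat list \<Rightarrow> nat \<Rightarrow> (nat \<times> item list) option" where
  "consistent_edge P x v = out_edge P v (map_option (\<lambda>i. x ! i) (query P v))"

text \<open>The node reached from \<open>v\<close> after \<open>t\<close> steps on input \<open>x\<close>; \<open>None\<close> if a sink was met earlier.\<close>

primrec walk :: "bprog \<Rightarrow> nat list \<Rightarrow> nat \<Rightarrow> nat \<Rightarrow> nat option" where
  "walk P x v 0 = Some v"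
| "walk P x v (Suc t) =
     Option.bind (walk P x v t) (\<lambda>u. map_option fst (consistent_edge P x u))"

definition emitted :: "bprog \<Rightarrow> nat list \<Rightarrow> nat \<Rightarrow> nat \<Rightarrow> item list" where
  "emitted P x v t =
     (case Option.bind (walk P x v t) (consistent_edge P x) of None \<Rightarrow> [] | Some (w, os) \<Rightarrow> os)"

definition outputs_from :: "bprog \<Rightarrow> nat list \<Rightarrow> nat \<Rightarrow> item list" where
  "outputs_from P x v = concat (map (emitted P x v) [0..<Suc (height P)])"

abbreviation visited :: "bprog \<Rightarrow> nat list \<Rightarrow> nat \<Rightarrow> nat option" where
  "visited P x t \<equiv> walk P x (start P) t"

abbreviation emitted_at :: "bprog \<Rightarrow> nat list \<Rightarrow> nat \<Rightarrow> item list" where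
  "emitted_at P x t \<equiv> emitted P x (start P) t"

definition encoded_bp :: "nat \<Rightarrow> nat \<Rightarrow> bprog \<Rightarrow> bool" where
  "encoded_bp n N P \<longleftrightarrow>
     leveled_bp n N P \<and>
     enc P (start P) = ([], []) \<and>
     blank P \<subseteq> nodes P \<and>
     (\<forall>u\<in>blank P. \<forall>v\<in>blank P. level P u = level P v \<longrightarrow> u = v) \<and>
     (\<forall>v\<in>blank P. enc P v = ([], []) \<and> (\<forall>x\<in>inputs n N. outputs_from P x v = [])) \<and>
     (\<forall>u\<in>nodes P - blank P. \<forall>v\<in>nodes P - blank P.
         level P u = level P v \<and> enc P u = enc P v \<longrightarrow> u = v)"

definition node_length :: "bprog \<Rightarrow> nat \<Rightarrow> nat" where
  "node_length P v = length (fst (enc P v)) + length (snd (enc P v))"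

definition cum_mem :: "bprog \<Rightarrow> nat list \<Rightarrow> nat" where
  "cum_mem P x =
     (\<Sum>t\<le>height P. case visited P x t of None \<Rightarrow> 0 | Some v \<Rightarrow> node_length P v)"

text \<open>Level of the last output of the run, by convention 0 for a run without any output.\<close>

definition last_output :: "bprog \<Rightarrow> nat list \<Rightarrow> nat" where
  "last_output P x = Max (insert 0 {t. t \<le> height P \<and> emitted_at P x t \<noteq> []})"

text \<open>
  The output list must consist of exactly the required items, each emitted once (in any order).
\<close>

definition produces :: "bprog \<Rightarrow> nat list \<Rightarrow> (nat \<Rightarrow> nat) \<Rightarrow> bool" where
  "produces P x f \<longleftrightarrow>
     distinct (outputs_from P x (start P)) \<and>
     set (outputs_from P x (start P)) = {(i, f i) |i. i < length x}"

text \<open>Equal integers are ranked by position.\<close>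

definition rank_in :: "nat list \<Rightarrow> nat \<Rightarrow> nat" where
  "rank_in x i = card {j. j < length x \<and> (x ! j < x ! i \<or> x ! j = x ! i \<and> j \<le> i)}"

definition ranks_correctly :: "bprog \<Rightarrow> nat list \<Rightarrow> bool" where
  "ranks_correctly P x \<longleftrightarrow> produces P x (rank_in x)"

definition sorts_correctly :: "bprog \<Rightarrow> nat list \<Rightarrow> bool" where
  "sorts_correctly P x \<longleftrightarrow> produces P x (\<lambda>p. sort x ! p)"

definition computes_Rank :: "nat \<Rightarrow> nat \<Rightarrow> bprog \<Rightarrow> bool" where
  "computes_Rank n N P \<longleftrightarrow> (\<forall>x\<in>inputs n N. ranks_correctly P x)"

definition computes_Sort :: "nat \<Rightarrow> nat \<Rightarrow> bprog \<Rightarrow> bool" where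
  "computes_Sort n N P \<longleftrightarrow> (\<forall>x\<in>inputs n N. sorts_correctly P x)"

definition \<mu> :: "nat \<Rightarrow> nat list pmf" where
  "\<mu> n = pmf_of_set {x \<in> inputs n (n^2). distinct x}"

text \<open>The disjunction of the two lower bounds, with \<open>\<epsilon>\<close> as the constant of both.\<close>

definition costly :: "real \<Rightarrow> nat \<Rightarrow> bprog \<Rightarrow> nat list \<Rightarrow> bool" where
  "costly \<epsilon> n P x \<longleftrightarrow>
     real (last_output P x) \<ge> \<epsilon> * (real n ^ 2 / log 2 (real n) ^ 2) \<or>
     real (cum_mem P x) \<ge> \<epsilon> * (real n ^ 2 / log 2 (real n))"

text \<open>The lexicographic pairing of \<open>{1..N} \<times> {1..n}\<close> with \<open>{1..n * N}\<close>.\<close>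

definition pairing :: "nat \<Rightarrow> nat \<Rightarrow> nat \<Rightarrow> nat" where
  "pairing n a i = (a - 1) * n + i"

definition tagged :: "nat list \<Rightarrow> nat list" where
  "tagged y = map (\<lambda>i. pairing (length y) (y ! i) (Suc i)) [0..<length y]"

text \<open>
  The sorting program run on tagged inputs: at a node querying position \<open>i\<close> (whose tag is \<open>i + 1\<close>),
  content \<open>a\<close> selects the edge labeled by the pair of \<open>a\<close> and the tag; an emitted item
  \<open>(p, z)\<close>, where \<open>z\<close> is a pair, is read as: the integer whose tag is in \<open>z\<close> has rank \<open>p + 1\<close>.
\<close>

definition rank_of_sort :: "nat \<Rightarrow> bprog \<Rightarrow> bprog" where
  "rank_of_sort n P = P\<lparr>out_edge := \<lambda>v l.
     map_option (\<lambda>(w, os). (w, map (\<lambda>(p, z). ((z - 1) mod n, p + 1)) os))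
       (case (query P v, l) of
          (Some i, Some a) \<Rightarrow>
            if a \<in> {1..n^2} then out_edge P v (Some (pairing n a (Suc i))) else None
        | _ \<Rightarrow> out_edge P v l)\<rparr>"

end

theory Submission
  imports Defs "HOL-Real_Asymp.Real_Asymp"
begin

text \<open>
  Cut the run into blocks of \<open>n div 2\<close> levels. For uniform independent contents, a block that
  starts at a fixed node emits \<open>k\<close> items, all of them correct ranks, with probability at most
  \<open>2 powr - \<Omega>(k / log n)\<close>, up to a factor polynomial in \<open>n\<close>: ranks of unread positions are
  guesses about contents that may still be swapped; the read contents do not concentrate in few of the
  \<open>n\<close> buckets of \<open>n\<close> consecutive integers; and the rank of a read content depends on how many
  unread contents fall below it, which is undecided independently for buckets far from each other.
  There are at most \<open>(l + 1) * 2 ^ l\<close> nonblank nodes of length \<open>l\<close> at a level, so by a union bound,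
  except with probability below \<open>n powr - c / 32\<close>, the block at any visited node of length \<open>l\<close>
  emits \<open>O(log n * (l + log n))\<close> items in a correct run. Summing this over all levels up to the last
  output, where almost every item is counted \<open>n div 2\<close> times, bounds \<open>n * (n div 2)\<close> by
  \<open>O(log n * cum_mem + log\<^sup>2 n * last_output)\<close> up to lower order terms.
\<close>

section \<open>Adaptive reading of a uniform list\<close>

text \<open>Blocks are analysed on lists with independent contents, repetitions allowed, because
  replacing a content by its translate may create a repetition: it acts on a cylinder, but not on
  the distinct lists in it. Passing to distinct lists costs only a constant factor in the end. Swaps
  of two contents keep distinctness, and use it to read the order of the two contents off their
  ranks. The length \<open>n div 2\<close> leaves at least half of the contents unread, and with
  \<open>n\<close> buckets each unread content meets a given pair of buckets with probability
  \<open>2/n\<close>; so a neighbourhood is met with constant probability. These events are not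
  independent for different buckets. The average of \<open>(1/2) ^ k\<close>, with \<open>k\<close>
  the number of met neighbourhoods, is therefore expanded into a sum over sets of avoided ones,
  whose probabilities are plain powers. The node at a level depends on the input, so a bound for a
  fixed node must be summed over all nodes of the level. Weights \<open>(1/4) ^ length\<close> make
  this sum bounded. Blank nodes may share the empty encoding with another node; they are left out,
  as they emit nothing.\<close>

lemma inputs_iff:
  "x \<in> inputs n N \<longleftrightarrow> length x = n \<and> (\<forall>i<n. x ! i \<in> {1..N})"
  by (auto simp: inputs_def subset_iff in_set_conv_nth)

lemma finite_inputs [simp]: "finite (inputs n N)"
  unfolding inputs_def by (rule finite_subset[OF _ finite_lists_length_eq[of "{1..N}" n]]) auto

lemma real_le_half_power_mult:
  assumes "2 ^ k * a \<le> (b :: nat)"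
  shows "real a \<le> (1/2) ^ k * real b"
proof -
  have "real (2 ^ k * a) \<le> real b" using assms by (simp only: of_nat_le_iff)
  then show ?thesis by (simp add: power_one_over field_simps)
qed

section \<open>Counting lists in product sets, and halving by constraints\<close>

lemma card_lists_nth:
  "card {y. length y = n \<and> (\<forall>i<n. y ! i \<in> F i)} = (\<Prod>i<n. card (F i))"
proof (induction n arbitrary: F)
  case 0
  have "{y. length y = 0 \<and> (\<forall>i<0. y ! i \<in> F i)} = {[]}" by auto
  then show ?case by simp
next
  case (Suc n)
  let ?S = "{y. length y = n \<and> (\<forall>i<n. y ! i \<in> F (Suc i))}"
  have "{y. length y = Suc n \<and> (\<forall>i<Suc n. y ! i \<in> F i)} = (\<lambda>(a, l). a # l) ` (F 0 \<times> ?S)"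
  proof (intro set_eqI iffI)
    fix y assume y: "y \<in> {y. length y = Suc n \<and> (\<forall>i<Suc n. y ! i \<in> F i)}"
    then obtain a l where l: "y = a # l" "length l = n" by (auto simp: length_Suc_conv)
    have "a \<in> F 0" using y l by (auto dest: spec[of _ 0])
    moreover have "l ! i \<in> F (Suc i)" if "i < n" for i using y l that by (auto dest: spec[of _ "Suc i"])
    ultimately show "y \<in> (\<lambda>(a, l). a # l) ` (F 0 \<times> ?S)" using l by auto
  qed (auto simp: less_Suc_eq_0_disj)
  moreover have "inj_on (\<lambda>(a, l). a # l) (F 0 \<times> ?S)"
    by (auto simp: inj_on_def)
  ultimately have "card {y. length y = Suc n \<and> (\<forall>i<Suc n. y ! i \<in> F i)} = card (F 0 \<times> ?S)"
    by (simp add: card_image)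
  also have "\<dots> = card (F 0) * (\<Prod>i<n. card (F (Suc i)))"
    using Suc.IH[of "\<lambda>i. F (Suc i)"] by (simp add: card_cartesian_product)
  finally show ?case by (simp only: prod.lessThan_Suc_shift comp_def)
qed

lemma card_inputs: "card (inputs n N) = N ^ n"
proof -
  have "inputs n N = {y. length y = n \<and> (\<forall>i<n. y ! i \<in> {1..N})}"
    by (auto simp only: inputs_iff)
  then have "card (inputs n N) = (\<Prod>i<n. card {1..N})"
    by (simp only: card_lists_nth)
  then show ?thesis by simp
qed

text \<open>Each map \<open>\<phi> j\<close> violates the constraint \<open>c j\<close> and touches no other, so every constraint
  halves the set.\<close>

lemma card_constraints_le:
  assumes "finite J" "finite C"
    and "\<And>j y. j \<in> J \<Longrightarrow> y \<in> C \<Longrightarrow> \<phi> j y \<in> C"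
    and "\<And>j. j \<in> J \<Longrightarrow> inj_on (\<phi> j) C"
    and "\<And>j y. j \<in> J \<Longrightarrow> y \<in> C \<Longrightarrow> c j y \<Longrightarrow> \<not> c j (\<phi> j y)"
    and "\<And>i j y. i \<in> J \<Longrightarrow> j \<in> J \<Longrightarrow> i \<noteq> j \<Longrightarrow> y \<in> C \<Longrightarrow> c i (\<phi> j y) = c i y"
  shows "2 ^ card J * card {y \<in> C. \<forall>j\<in>J. c j y} \<le> card C"
  using assms
proof (induction J)
  case empty
  then show ?case by simp
next
  case (insert k J)
  let ?E = "{y \<in> C. \<forall>j\<in>J. c j y}" and ?E' = "{y \<in> C. \<forall>j\<in>insert k J. c j y}"
  have IH: "2 ^ card J * card ?E \<le> card C"
    by (rule insert.IH) (use insert.prems in auto)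
  have sub: "\<phi> k ` ?E' \<subseteq> ?E - ?E'"
  proof
    fix z assume "z \<in> \<phi> k ` ?E'"
    then obtain y where y: "y \<in> ?E'" "z = \<phi> k y" by auto
    have "c j z" if "j \<in> J" for j
      using insert.prems(5)[of j k y] insert.hyps that y by auto
    then show "z \<in> ?E - ?E'"
      using y insert.prems(2)[of k y] insert.prems(4)[of k y] by auto
  qed
  have inj: "inj_on (\<phi> k) ?E'"
    by (rule inj_on_subset[OF insert.prems(3)[of k]]) auto
  have fin: "finite ?E" "finite ?E'" using insert.prems(1) by auto
  have "card ?E' = card (\<phi> k ` ?E')" by (simp only: card_image[OF inj])
  also have "\<dots> \<le> card (?E - ?E')" using fin sub by (intro card_mono) auto
  also have "\<dots> = card ?E - card ?E'" using fin by (intro card_Diff_subset) auto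
  finally have "2 * card ?E' \<le> card ?E"
    using card_mono[of ?E ?E'] fin by auto
  then have "2 ^ card J * (2 * card ?E') \<le> 2 ^ card J * card ?E" by simp
  then have "2 ^ card J * (2 * card ?E') \<le> card C" using IH by linarith
  then show ?case using insert.hyps by (simp add: mult.left_commute)
qed

text \<open>A decision tree seen from outside: \<open>nxt t x\<close> is the position read at time
  \<open>t\<close>, \<open>None\<close> if nothing is read. By the second assumption the choice
  depends only on the contents read earlier on \<open>x\<close>. A position may be read
  repeatedly.\<close>

locale adaptive_reading =
  fixes n N :: nat and nxt :: "nat \<Rightarrow> nat list \<Rightarrow> nat option"
  assumes nxt_bound: "x \<in> inputs n N \<Longrightarrow> nxt t x = Some i \<Longrightarrow> i < n"
    and nxt_adaptive: "(\<And>s i. s < t \<Longrightarrow> nxt s x = Some i \<Longrightarrow> y ! i = x ! i) \<Longrightarrow> nxt t y = nxt t x"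
begin

definition seen :: "nat \<Rightarrow> nat list \<Rightarrow> nat set" where
  "seen t x = {i. \<exists>s<t. nxt s x = Some i}"

text \<open>The inputs that pass the same first \<open>t\<close> readings as \<open>x\<close>, with
  the same answers. These cylinders partition \<open>inputs n N\<close>, and each is a product set
  in which the unread positions are free.\<close>

definition cyl :: "nat \<Rightarrow> nat list \<Rightarrow> nat list set" where
  "cyl t x = {y \<in> inputs n N. \<forall>i\<in>seen t x. y ! i = x ! i}"

lemma seen_0 [simp]: "seen 0 x = {}"
  by (simp add: seen_def)

lemma seen_Suc: "seen (Suc t) x = seen t x \<union> set_option (nxt t x)"
  by (auto simp: seen_def less_Suc_eq)

lemma finite_seen [simp]: "finite (seen t x)"
  by (induction t) (auto simp: seen_Suc)

lemma card_seen_le: "card (seen t x) \<le> t"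
proof (induction t)
  case (Suc t)
  have "card (seen (Suc t) x) \<le> card (seen t x) + card (set_option (nxt t x))"
    unfolding seen_Suc by (rule card_Un_le)
  moreover have "card (set_option (nxt t x)) \<le> 1" by (cases "nxt t x") auto
  ultimately show ?case using Suc by linarith
qed simp

lemma seen_subset: "x \<in> inputs n N \<Longrightarrow> seen t x \<subseteq> {..<n}"
  using nxt_bound by (auto simp: seen_def)

lemma finite_cyl [simp]: "finite (cyl t x)"
  by (simp add: cyl_def)

lemma self_in_cyl: "x \<in> inputs n N \<Longrightarrow> x \<in> cyl t x"
  by (simp add: cyl_def)

lemma cyl_subset: "cyl t x \<subseteq> inputs n N"
  by (auto simp: cyl_def)

text \<open>The bound includes \<open>s = t\<close>: the position read at time \<open>t\<close> is
  fixed by the contents read before it. Hence a content read for the first time at time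
  \<open>t\<close> is still uniform on the cylinder.\<close>

lemma nxt_cong: "y \<in> cyl t x \<Longrightarrow> s \<le> t \<Longrightarrow> nxt s y = nxt s x"
  by (rule nxt_adaptive) (force simp: cyl_def seen_def)

lemma seen_cong: "y \<in> cyl t x \<Longrightarrow> seen t y = seen t x"
  using nxt_cong[of y t x] by (auto simp: seen_def)

lemma cyl_cong: "y \<in> cyl t x \<Longrightarrow> cyl t y = cyl t x"
  using seen_cong[of y t x] by (auto simp: cyl_def)

text \<open>Total expectation over the partition into cylinders: by \<open>cyl_cong\<close>, two of
  them are equal or disjoint.\<close>

lemma sum_le_if_sum_cyl_le:
  fixes f g :: "nat list \<Rightarrow> real"
  assumes "\<And>x. x \<in> inputs n N \<Longrightarrow> sum f (cyl t x) \<le> d * sum g (cyl t x)"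
  shows "sum f (inputs n N) \<le> d * sum g (inputs n N)"
proof -
  let ?K = "cyl t ` inputs n N"
  have U: "\<Union>?K = inputs n N" using self_in_cyl cyl_subset by blast
  have disj: "\<forall>A\<in>?K. \<forall>B\<in>?K. A \<noteq> B \<longrightarrow> A \<inter> B = {}"
    using cyl_cong by blast
  have split: "sum e (inputs n N) = (\<Sum>A\<in>?K. sum e A)" for e :: "nat list \<Rightarrow> real"
    using sum.Union_disjoint[of ?K e] disj U by auto
  show ?thesis
    unfolding split sum_distrib_left[of d _ ?K] by (intro sum_mono) (use assms in auto)
qed

text \<open>Only cylinders that meet \<open>E\<close> need a bound, so the reference input
  \<open>x\<close> may be taken from \<open>E\<close> itself. Ranks emitted throughout the cylinder
  can then be compared with the ranks in \<open>x\<close>.\<close>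

lemma card_le_if_card_cyl_le:
  fixes d :: real
  assumes "E \<subseteq> inputs n N"
    and "\<And>x. x \<in> E \<Longrightarrow> real (card (E \<inter> cyl t x)) \<le> d * card (cyl t x)" and "d \<ge> 0"
  shows "real (card E) \<le> d * card (inputs n N)"
proof -
  have "(\<Sum>y\<in>inputs n N. indicat_real E y) \<le> d * (\<Sum>y\<in>inputs n N. 1 :: real)"
  proof (rule sum_le_if_sum_cyl_le)
    fix x assume "x \<in> inputs n N"
    have *: "(\<Sum>y\<in>cyl t x. indicat_real E y) = card (E \<inter> cyl t x)"
      by (simp add: indicator_def of_bool_def sum.If_cases Int_def conj_commute)
    show "(\<Sum>y\<in>cyl t x. indicat_real E y) \<le> d * (\<Sum>y\<in>cyl t x. 1 :: real)"
    proof (cases "E \<inter> cyl t x = {}")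
      case True
      then show ?thesis using assms(3) by (simp add: *)
    next
      case False
      then obtain z where "z \<in> E" "z \<in> cyl t x" by auto
      then show ?thesis using assms(2)[of z] cyl_cong[of z t x] * by simp
    qed
  qed
  moreover have "inputs n N \<inter> E = E" using assms(1) by auto
  ultimately show ?thesis by (simp add: indicator_def of_bool_def sum.If_cases Int_def)
qed

lemma cyl_iff:
  assumes "x \<in> inputs n N"
  shows "y \<in> cyl t x \<longleftrightarrow>
    length y = n \<and> (\<forall>i<n. y ! i \<in> (if i \<in> seen t x then {x ! i} else {1..N}))"
proof
  assume "y \<in> cyl t x"
  then show "length y = n \<and> (\<forall>i<n. y ! i \<in> (if i \<in> seen t x then {x ! i} else {1..N}))"
    by (simp add: cyl_def inputs_iff)
next
  assume R: "length y = n \<and> (\<forall>i<n. y ! i \<in> (if i \<in> seen t x then {x ! i} else {1..N}))"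
  have eq: "y ! i = x ! i" if "i \<in> seen t x" for i
    using R that seen_subset[OF assms, of t] by (auto dest!: spec[of _ i])
  have "y ! i \<in> {1..N}" if "i < n" for i
    using R that eq[of i] assms by (cases "i \<in> seen t x") (auto simp: inputs_iff)
  with R eq show "y \<in> cyl t x" by (simp add: cyl_def inputs_iff)
qed

lemma card_cyl_in:
  assumes "x \<in> inputs n N" "A \<subseteq> {1..N}"
  shows "card {y \<in> cyl t x. \<forall>i\<in>{..<n} - seen t x. y ! i \<in> A} = card A ^ (n - card (seen t x))"
proof -
  let ?F = "\<lambda>i. if i \<in> seen t x then {x ! i} else A"
  have "{y \<in> cyl t x. \<forall>i\<in>{..<n} - seen t x. y ! i \<in> A} =
      {y. length y = n \<and> (\<forall>i<n. y ! i \<in> ?F i)}"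
    unfolding cyl_iff[OF assms(1)] using assms(2)
    by (intro Collect_cong) (simp only: subset_eq split: if_splits, blast)
  then have "card {y \<in> cyl t x. \<forall>i\<in>{..<n} - seen t x. y ! i \<in> A} = (\<Prod>i<n. card (?F i))"
    by (simp only: card_lists_nth)
  also have "\<dots> = (\<Prod>i\<in>{..<n} - seen t x. card A)"
    by (rule prod.mono_neutral_cong_right) auto
  also have "\<dots> = card A ^ (n - card (seen t x))"
    using seen_subset[OF assms(1), of t] by (simp add: card_Diff_subset)
  finally show ?thesis .
qed

lemma card_cyl: "x \<in> inputs n N \<Longrightarrow> card (cyl t x) = N ^ (n - card (seen t x))"
proof -
  assume x: "x \<in> inputs n N"
  have "{y \<in> cyl t x. \<forall>i\<in>{..<n} - seen t x. y ! i \<in> {1..N}} = cyl t x"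
    by (auto simp: cyl_def inputs_iff)
  then show ?thesis using card_cyl_in[OF x, of "{1..N}" t] by simp
qed

lemma card_cyl_unread:
  assumes "x \<in> inputs n N" "A \<subseteq> {1..N}" "k < n" "k \<notin> seen t x"
  shows "N * card {y \<in> cyl t x. y ! k \<in> A} = card A * card (cyl t x)"
proof -
  define F where "F B i = (if i \<in> seen t x then {x ! i} else if i = k then B else {1..N})" for B i
  \<comment> \<open>The factors at the positions other than \<open>k\<close> do not depend on
    \<open>B\<close>, hence \<open>F {} i\<close>; comparing \<open>B = A\<close> with
    \<open>B = {1..N}\<close> gives the ratio.\<close>
  have gen: "card {y \<in> cyl t x. y ! k \<in> B} = card B * (\<Prod>i\<in>{..<n} - {k}. card (F {} i))"
    if B: "B \<subseteq> {1..N}" for B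
  proof -
    have "{y \<in> cyl t x. y ! k \<in> B} = {y. length y = n \<and> (\<forall>i<n. y ! i \<in> F B i)}"
      unfolding cyl_iff[OF assms(1)] F_def using B assms(3,4)
      by (intro Collect_cong) (simp only: subset_eq split: if_splits, blast)
    then have "card {y \<in> cyl t x. y ! k \<in> B} = (\<Prod>i<n. card (F B i))"
      by (simp only: card_lists_nth)
    also have "\<dots> = card (F B k) * (\<Prod>i\<in>{..<n} - {k}. card (F B i))"
      by (rule prod.remove) (use assms in auto)
    also have "(\<Prod>i\<in>{..<n} - {k}. card (F B i)) = (\<Prod>i\<in>{..<n} - {k}. card (F {} i))"
      by (rule prod.cong) (auto simp: F_def)
    also have "card (F B k) = card B" using assms by (simp add: F_def)
    finally show ?thesis .
  qed
  have "{y \<in> cyl t x. y ! k \<in> {1..N}} = cyl t x"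
    using assms(3) by (auto simp: cyl_def inputs_iff)
  with gen[of "{1..N}"] gen[OF assms(2)] show ?thesis by simp
qed

text \<open>Every newly read content is uniform given the earlier ones, so adaptivity does not matter.\<close>

lemma sum_power_read_le:
  assumes "A \<subseteq> {1..N}" "N > 0"
  shows "(\<Sum>x\<in>inputs n N. 8 ^ card {i \<in> seen t x. x ! i \<in> A}) \<le> (1 + 7 * card A / N) ^ t * real N ^ n"
proof (induction t)
  case 0
  then show ?case by (simp add: card_inputs)
next
  case (Suc t)
  let ?w = "\<lambda>t x. 8 ^ card {i \<in> seen t x. x ! i \<in> A} :: real"
  have "(\<Sum>x\<in>inputs n N. ?w (Suc t) x) \<le> (1 + 7 * card A / N) * (\<Sum>x\<in>inputs n N. ?w t x)"
  proof (rule sum_le_if_sum_cyl_le)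
    fix x assume x: "x \<in> inputs n N"
    have wt: "?w t y = ?w t x" if "y \<in> cyl t x" for y
    proof -
      have "{i \<in> seen t y. y ! i \<in> A} = {i \<in> seen t x. x ! i \<in> A}"
        using seen_cong[OF that] that by (auto simp: cyl_def)
      then show ?thesis by simp
    qed
    have s: "seen (Suc t) y = seen t x \<union> set_option (nxt t x)" if "y \<in> cyl t x" for y
      using seen_cong[OF that] nxt_cong[OF that, of t] by (simp add: seen_Suc)
    \<comment> \<open>Either the step reads nothing new, or it reads a new position
      \<open>k\<close>, the same one on the whole cylinder.\<close>
    consider "set_option (nxt t x) \<subseteq> seen t x" | k where "nxt t x = Some k" "k \<notin> seen t x"
      by (cases "nxt t x") auto
    then show "(\<Sum>y\<in>cyl t x. ?w (Suc t) y) \<le> (1 + 7 * card A / N) * (\<Sum>y\<in>cyl t x. ?w t y)"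
    proof cases
      case 1
      have "?w (Suc t) y = ?w t y" if "y \<in> cyl t x" for y
      proof -
        have "seen (Suc t) y = seen t y" using s[OF that] seen_cong[OF that] 1 by auto
        then show ?thesis by simp
      qed
      then have "(\<Sum>y\<in>cyl t x. ?w (Suc t) y) = (\<Sum>y\<in>cyl t x. ?w t y)"
        by (rule sum.cong[OF refl])
      also have "\<dots> \<le> (1 + 7 * card A / N) * \<dots>"
        using mult_right_mono[of 1 "1 + 7 * card A / N" "\<Sum>y\<in>cyl t x. ?w t y"]
        by (simp add: sum_nonneg)
      finally show ?thesis .
    next
      case 2
      have kn: "k < n" using nxt_bound[OF x 2(1)] .
      \<comment> \<open>Since 8 = 1 + 7, the change of the weight is linear in the indicator of a
        new content in \<open>A\<close> and averages to \<open>1 + 7 * card A / N\<close>.\<close>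
      have w: "?w (Suc t) y = ?w t x * (1 + 7 * of_bool (y ! k \<in> A))" if "y \<in> cyl t x" for y
      proof -
        have "{i \<in> seen (Suc t) y. y ! i \<in> A} =
            {i \<in> seen t y. y ! i \<in> A} \<union> (if y ! k \<in> A then {k} else {})"
          using s[OF that] seen_cong[OF that] 2 by auto
        moreover have "k \<notin> seen t y" using seen_cong[OF that] 2 by auto
        ultimately have "?w (Suc t) y = ?w t y * (1 + 7 * of_bool (y ! k \<in> A))"
          by (simp add: card_insert_if)
        then show ?thesis using wt[OF that] by simp
      qed
      have "(\<Sum>y\<in>cyl t x. of_bool (y ! k \<in> A)) = real (card {y \<in> cyl t x. y ! k \<in> A})"
        by (simp add: of_bool_def sum.If_cases Int_def)
      also have "\<dots> = card A / N * card (cyl t x)"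
        using arg_cong[OF card_cyl_unread[OF x assms(1) kn 2(2)], of real] assms(2)
        by (simp add: field_simps)
      finally have "(\<Sum>y\<in>cyl t x. of_bool (y ! k \<in> A)) = card A / N * card (cyl t x)" .
      then have "(\<Sum>y\<in>cyl t x. 1 + 7 * of_bool (y ! k \<in> A)) = (1 + 7 * card A / N) * card (cyl t x)"
        by (simp add: sum.distrib sum_distrib_left[symmetric] algebra_simps)
      then have "(\<Sum>y\<in>cyl t x. ?w (Suc t) y) = ?w t x * ((1 + 7 * card A / N) * card (cyl t x))"
        using w by (simp add: sum_distrib_left[symmetric])
      also have "\<dots> = (1 + 7 * card A / N) * (\<Sum>y\<in>cyl t x. ?w t y)"
        using wt by simp
      finally show ?thesis by simp
    qed
  qed
  also have "\<dots> \<le> (1 + 7 * card A / N) * ((1 + 7 * card A / N) ^ t * real N ^ n)"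
    by (rule mult_left_mono[OF Suc.IH]) auto
  finally show ?case by (simp add: mult.assoc)
qed

end

section \<open>Ranks and buckets\<close>

abbreviation below :: "nat list \<Rightarrow> nat \<Rightarrow> nat \<Rightarrow> bool" where
  "below y j i \<equiv> y ! j < y ! i \<or> y ! j = y ! i \<and> j \<le> i"

lemma rank_in_less_iff:
  assumes "i < length y" "j < length y" "y ! i \<noteq> y ! j"
  shows "rank_in y i < rank_in y j \<longleftrightarrow> y ! i < y ! j"
proof -
  have less: "rank_in y i < rank_in y j" if "i < length y" "j < length y" "y ! i < y ! j" for i j
    unfolding rank_in_def
  proof (rule psubset_card_mono)
    have "j \<in> {k. k < length y \<and> below y k j}" "j \<notin> {k. k < length y \<and> below y k i}"
      using that by auto
    moreover have "{k. k < length y \<and> below y k i} \<subseteq> {k. k < length y \<and> below y k j}"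
      using that by auto
    ultimately show "{k. k < length y \<and> below y k i} \<subset> {k. k < length y \<and> below y k j}" by blast
  qed simp
  from less[of i j] less[of j i] assms show ?thesis by (meson linorder_neqE_nat order_less_asym)
qed

lemma rank_in_split:
  assumes "p < length y"
  shows "rank_in y k = card {j. j < length y \<and> j \<noteq> p \<and> below y j k} + of_bool (below y p k)"
proof -
  have "{j. j < length y \<and> below y j k} =
      {j. j < length y \<and> j \<noteq> p \<and> below y j k} \<union> (if below y p k then {p} else {})"
    using assms by auto
  then show ?thesis unfolding rank_in_def by simp
qed

text \<open>The other positions contribute the same before and after, so the rank of
  \<open>k\<close> notices only whether the content at \<open>p\<close> changes sides relative to
  the content at \<open>k\<close>.\<close>

lemma rank_in_update:
  assumes "p < length y" "p \<noteq> k"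
  shows "rank_in (y[p := v]) k = rank_in y k \<longleftrightarrow>
    (v < y ! k \<or> v = y ! k \<and> p \<le> k \<longleftrightarrow> below y p k)"
proof -
  have "{j. j < length y \<and> j \<noteq> p \<and> below (y[p := v]) j k} = {j. j < length y \<and> j \<noteq> p \<and> below y j k}"
    using assms by auto
  then show ?thesis
    using assms rank_in_split[of p y k] rank_in_split[of p "y[p := v]" k] by (auto simp: of_bool_def)
qed

section \<open>Buckets of values, and translation by two buckets\<close>

definition bucket :: "nat \<Rightarrow> nat \<Rightarrow> nat" where
  "bucket n v = (v - 1) div n"

lemma bucket_less: "v \<in> {1..n^2} \<Longrightarrow> bucket n v < n"
  unfolding bucket_def by (cases "n = 0") (auto simp: less_mult_imp_div_less power2_eq_square)

lemma less_if_bucket_less: "bucket n a < bucket n b \<Longrightarrow> a < b"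
  unfolding bucket_def by (metis diff_le_mono div_le_mono leI leD)

lemma less_iff_bucket_less: "bucket n a \<noteq> bucket n b \<Longrightarrow> a < b \<longleftrightarrow> bucket n a < bucket n b"
  using less_if_bucket_less[of n a b] less_if_bucket_less[of n b a] by linarith

lemma bucket_add:
  assumes "n > 0" "v \<ge> 1"
  shows "bucket n (v + 2 * n) = bucket n v + 2"
proof -
  have "v + 2 * n - 1 = (v - 1) + 2 * n" using assms by simp
  then show ?thesis unfolding bucket_def using assms by (simp only: div_mult_self1)
qed

lemma bucket_le: "n > 0 \<Longrightarrow> bucket n v < n \<Longrightarrow> v \<le> n^2"
proof -
  assume n: "n > 0" and "bucket n v < n"
  then have "v - 1 < n * n" unfolding bucket_def using div_less_iff_less_mult[OF n] by blast
  then show "v \<le> n^2" by (simp add: power2_eq_square)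
qed

lemma bucket_diff:
  assumes "n > 0" "bucket n v \<ge> 2"
  shows "v > 2 * n" "bucket n (v - 2 * n) = bucket n v - 2"
proof -
  show "v > 2 * n"
    using assms less_eq_div_iff_mult_less_eq[of n 2 "v - 1"] by (simp add: bucket_def)
  then have "bucket n (v - 2 * n + 2 * n) = bucket n (v - 2 * n) + 2"
    using assms by (intro bucket_add) auto
  with \<open>v > 2 * n\<close> show "bucket n (v - 2 * n) = bucket n v - 2" by simp
qed

lemma card_bucket_vimage:
  assumes "B \<subseteq> {..<n}"
  shows "card {v \<in> {1..n^2}. bucket n v \<in> B} = n * card B"
proof (cases "n = 0")
  case False
  let ?f = "\<lambda>(b, r). b * n + r + 1"
  have "{v \<in> {1..n^2}. bucket n v \<in> B} = ?f ` (B \<times> {..<n})"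
  proof (intro set_eqI iffI)
    fix v assume v: "v \<in> {v \<in> {1..n^2}. bucket n v \<in> B}"
    then have "v = ?f (bucket n v, (v - 1) mod n)" by (simp add: bucket_def)
    moreover have "(bucket n v, (v - 1) mod n) \<in> B \<times> {..<n}" using v False by auto
    ultimately show "v \<in> ?f ` (B \<times> {..<n})" by (rule image_eqI)
  next
    fix v assume "v \<in> ?f ` (B \<times> {..<n})"
    then obtain b r where br: "v = b * n + r + 1" "b \<in> B" "r < n" by auto
    then have "bucket n v = b" using False by (simp add: bucket_def)
    moreover have "v \<le> n^2" using bucket_le[of n v] calculation br assms False by auto
    ultimately show "v \<in> {v \<in> {1..n^2}. bucket n v \<in> B}" using br by simp
  qed
  moreover have "inj_on ?f (B \<times> {..<n})"
  proof (rule inj_onI, clarsimp)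
    fix a r b s assume *: "a * n + r = b * n + s" "r < n" "s < n"
    have "(a * n + r) div n = a" "(b * n + s) div n = b" using *(2,3) by simp_all
    with *(1) have "a = b" by metis
    with *(1) show "a = b \<and> r = s" by simp
  qed
  ultimately show ?thesis by (simp add: card_image card_cartesian_product)
qed auto

context adaptive_reading
begin

text \<open>Contents of unread positions may be swapped within the cylinder.\<close>

lemma card_ranks_unread_le:
  assumes x: "x \<in> inputs n N" and D: "D \<subseteq> {..<n} - seen t x" "2 * p \<le> card D"
  shows "2 ^ p * card {y \<in> cyl t x. distinct y \<and> (\<forall>i\<in>D. rank_in y i = r i)} \<le> card (cyl t x)"
proof -
  obtain D' where D': "D' \<subseteq> D" "card D' = 2 * p" "finite D'"
    by (rule obtain_subset_with_card_n[OF D(2)])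
  obtain a where a: "bij_betw a {0..<2 * p} D'"
    using ex_bij_betw_nat_finite[OF D'(3)] D'(2) by auto
  have aD: "a k \<in> D" "a k < n" "a k \<notin> seen t x" if "k < 2 * p" for k
  proof -
    have "a k \<in> D'" using bij_betwE[OF a] that by auto
    then show "a k \<in> D" "a k < n" "a k \<notin> seen t x" using D'(1) D(1) by blast+
  qed
  have a_eq: "a k = a l \<longleftrightarrow> k = l" if "k < 2 * p" "l < 2 * p" for k l
    using bij_betw_imp_inj_on[OF a] that by (auto simp: inj_on_eq_iff)
  \<comment> \<open>The positions are paired as \<open>(a 0, a 1)\<close>, \<open>(a 2, a 3)\<close>
    and so on; exchanges in different pairs act on disjoint positions.\<close>
  define u where "u j = a (2 * j)" for j
  define v where "v j = a (2 * j + 1)" for j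
  have uv: "u j < n" "v j < n" "u j \<notin> seen t x" "v j \<notin> seen t x" "u j \<in> D" "v j \<in> D" "u j \<noteq> v j"
    if "j < p" for j
    using that aD[of "2 * j"] aD[of "2 * j + 1"] a_eq[of "2 * j" "2 * j + 1"] by (auto simp: u_def v_def)
  have uv_eq: "u i \<noteq> u j" "u i \<noteq> v j" "v i \<noteq> u j" "v i \<noteq> v j" if "i < p" "j < p" "i \<noteq> j" for i j
    using that unfolding u_def v_def by (subst a_eq; presburger)+
  define \<phi> where "\<phi> j y = y[u j := y ! v j, v j := y ! u j]" for j and y :: "nat list"
  \<comment> \<open>Of the prescribed ranks only the order within each pair is used. Distinctness
    makes this order visible in the contents, and makes an exchange reverse it.\<close>
  define c where "c j y \<longleftrightarrow> (y ! u j < y ! v j \<longleftrightarrow> r (u j) < r (v j))" for j and y :: "nat list"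
  define C where "C = {y \<in> cyl t x. distinct y}"
  have len: "length y = n" if "y \<in> C" for y
    using that by (auto simp: C_def cyl_def inputs_def)
  have "2 ^ card {..<p} * card {y \<in> C. \<forall>j\<in>{..<p}. c j y} \<le> card C"
  proof (rule card_constraints_le[where \<phi> = \<phi>])
    fix j y assume j: "j \<in> {..<p}" and y: "y \<in> C"
    show "\<phi> j y \<in> C"
      using y uv[of j] j len[OF y] unfolding C_def \<phi>_def
      by (auto simp: cyl_def inputs_def set_swap nth_list_update)
    have "y ! u j \<noteq> y ! v j"
      using y uv[of j] j len[OF y] by (simp add: C_def nth_eq_iff_index_eq)
    then show "\<not> c j (\<phi> j y)" if "c j y"
      using that uv[of j] j len[OF y] by (auto simp: c_def \<phi>_def nth_list_update)
  next
    fix j assume j: "j \<in> {..<p}"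
    show "inj_on (\<phi> j) C"
    proof (rule inj_on_inverseI)
      fix y assume y: "y \<in> C"
      show "\<phi> j (\<phi> j y) = y"
        using uv[of j] j len[OF y] by (auto simp: \<phi>_def nth_list_update intro!: nth_equalityI)
    qed
  next
    fix i j y assume "i \<in> {..<p}" "j \<in> {..<p}" "i \<noteq> j" "y \<in> C"
    then show "c i (\<phi> j y) = c i y"
      using uv[of j] uv[of i] uv_eq[of i j] len[of y] by (auto simp: c_def \<phi>_def nth_list_update)
  qed (auto simp: C_def)
  moreover have "{y \<in> cyl t x. distinct y \<and> (\<forall>i\<in>D. rank_in y i = r i)} \<subseteq> {y \<in> C. \<forall>j\<in>{..<p}. c j y}"
  proof
    fix y assume "y \<in> {y \<in> cyl t x. distinct y \<and> (\<forall>i\<in>D. rank_in y i = r i)}"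
    then have y: "distinct y" "\<forall>i\<in>D. rank_in y i = r i" "y \<in> C" by (auto simp: C_def)
    have "c j y" if j: "j < p" for j
    proof -
      have "y ! u j \<noteq> y ! v j"
        using y(1) uv[OF j] len[OF y(3)] by (simp add: nth_eq_iff_index_eq)
      then show "c j y"
        using y(2) uv[OF j] len[OF y(3)] rank_in_less_iff[of "u j" y "v j"] by (simp add: c_def)
    qed
    with y(3) show "y \<in> {y \<in> C. \<forall>j\<in>{..<p}. c j y}" by simp
  qed
  then have "card {y \<in> cyl t x. distinct y \<and> (\<forall>i\<in>D. rank_in y i = r i)} \<le> card {y \<in> C. \<forall>j\<in>{..<p}. c j y}"
    by (rule card_mono[rotated]) (simp add: C_def)
  then have "2 ^ p * card {y \<in> cyl t x. distinct y \<and> (\<forall>i\<in>D. rank_in y i = r i)}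
      \<le> 2 ^ p * card {y \<in> C. \<forall>j\<in>{..<p}. c j y}" by simp
  moreover have "card C \<le> card (cyl t x)" by (rule card_mono) (auto simp: C_def)
  ultimately show ?thesis unfolding card_lessThan by linarith
qed

text \<open>For a read content in bucket \<open>\<beta>\<close>, an unread content of the bucket below may be exchanged
  with its translate in the bucket above: this changes the rank in question by one and no rank of a
  content that is at least three buckets away. Every \<open>\<beta>\<close> with an unread content in a neighbouring
  bucket thus yields a factor \<open>1/2\<close>, and each neighbourhood is unlikely to be avoided by all unread
  contents.\<close>

lemma card_ranks_spread_le:
  assumes N: "N = n^2" and x: "x \<in> inputs n N" and few: "2 * card (seen t x) \<le> n"
    and J: "\<And>\<beta>. \<beta> \<in> J \<Longrightarrow> 0 < \<beta> \<and> \<beta> + 1 < n"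
    and gap: "\<And>\<beta> \<beta>'. \<beta> \<in> J \<Longrightarrow> \<beta>' \<in> J \<Longrightarrow> \<beta> < \<beta>' \<Longrightarrow> \<beta> + 3 \<le> \<beta>'"
    and k: "\<And>\<beta>. \<beta> \<in> J \<Longrightarrow> k \<beta> \<in> seen t x \<and> bucket n (x ! k \<beta>) = \<beta>"
  shows "card {y \<in> cyl t x. \<forall>\<beta>\<in>J. rank_in y (k \<beta>) = r \<beta>} \<le> (3/4) ^ card J * card (cyl t x)"
proof (cases "J = {}")
  case True
  then show ?thesis by simp
next
  case False
  then have n: "n > 0" using J by fastforce
  have finJ: "finite J" by (rule finite_subset[of _ "{..<n}"]) (use J in force)+
  \<comment> \<open>Leaving out \<open>\<beta>\<close> itself excludes ties with the read content,
    so that a flip certainly carries a content to its other side.\<close>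
  define nbh where "nbh \<beta> = {\<beta> - 1, \<beta> + 1}" for \<beta> :: nat
  define win where "win y \<beta> = {p. p < n \<and> p \<notin> seen t x \<and> bucket n (y ! p) \<in> nbh \<beta>}" for y \<beta>
  define flip where "flip \<beta> v = (if bucket n v < \<beta> then v + 2 * n else v - 2 * n)" for \<beta> v
  \<comment> \<open>The least position of the window is a canonical choice: the flip preserves all
    windows, so a second application finds the same position and undoes the first.\<close>
  define \<phi> where "\<phi> \<beta> y = y[Min (win y \<beta>) := flip \<beta> (y ! Min (win y \<beta>))]" for \<beta> and y :: "nat list"
  have nbh_disj: "nbh \<beta> \<inter> nbh \<beta>' = {}" "\<beta>' \<notin> nbh \<beta>" if "\<beta> \<in> J" "\<beta>' \<in> J" "\<beta> \<noteq> \<beta>'" for \<beta> \<beta>'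
  proof -
    have "\<beta> + 3 \<le> \<beta>' \<or> \<beta>' + 3 \<le> \<beta>"
      using gap[OF that(1,2)] gap[OF that(2,1)] that(3) by linarith
    then show "nbh \<beta> \<inter> nbh \<beta>' = {}" "\<beta>' \<notin> nbh \<beta>" by (auto simp: nbh_def)
  qed
  have len: "length y = n" if "y \<in> cyl t x" for y
    using that by (auto simp: cyl_def inputs_def)
  have fwin: "finite (win y \<beta>)" for y \<beta> by (simp add: win_def)
  have flip: "flip \<beta> v \<in> {1..N} \<and> bucket n (flip \<beta> v) \<in> nbh \<beta> \<and> flip \<beta> (flip \<beta> v) = v \<and>
      (bucket n (flip \<beta> v) < \<beta> \<longleftrightarrow> \<not> bucket n v < \<beta>)"
    if "\<beta> \<in> J" "v \<in> {1..N}" "bucket n v \<in> nbh \<beta>" for \<beta> v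
  proof (cases "bucket n v < \<beta>")
    case True
    then have b: "bucket n v = \<beta> - 1" using that by (auto simp: nbh_def)
    have b': "bucket n (v + 2 * n) = \<beta> + 1"
      using bucket_add[OF n, of v] that b J[OF that(1)] by auto
    then have "v + 2 * n \<le> N" using bucket_le[OF n] J[OF that(1)] N by auto
    then show ?thesis using True b b' that by (auto simp: flip_def nbh_def)
  next
    case False
    then have b: "bucket n v = \<beta> + 1" using that J[OF that(1)] by (auto simp: nbh_def)
    with bucket_diff[OF n, of v] J[OF that(1)]
    have b': "bucket n (v - 2 * n) = \<beta> - 1" "v > 2 * n" by auto
    then show ?thesis using False b that J[OF that(1)] by (auto simp: flip_def nbh_def)
  qed
  have step: "\<phi> \<beta> y \<in> cyl t x \<and> (\<forall>\<beta>'\<in>J. win (\<phi> \<beta> y) \<beta>' = win y \<beta>') \<and> \<phi> \<beta> (\<phi> \<beta> y) = y \<and>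
      rank_in (\<phi> \<beta> y) (k \<beta>) \<noteq> rank_in y (k \<beta>) \<and>
      (\<forall>\<beta>'\<in>J. \<beta>' \<noteq> \<beta> \<longrightarrow> rank_in (\<phi> \<beta> y) (k \<beta>') = rank_in y (k \<beta>'))"
    if \<beta>: "\<beta> \<in> J" and y: "y \<in> cyl t x" and ne: "win y \<beta> \<noteq> {}" for \<beta> y
  proof -
    define p where "p = Min (win y \<beta>)"
    define v where "v = y ! p"
    have "p \<in> win y \<beta>" unfolding p_def using fwin ne by (rule Min_in)
    then have p: "p < n" "p \<notin> seen t x" "bucket n v \<in> nbh \<beta>" by (auto simp: win_def v_def)
    have vN: "v \<in> {1..N}" using y p(1) by (auto simp: cyl_def inputs_iff v_def)
    note fl = flip[OF \<beta> vN p(3)]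
    have eq: "\<phi> \<beta> y = y[p := flip \<beta> v]" by (simp add: \<phi>_def p_def v_def)
    have mem: "\<phi> \<beta> y \<in> cyl t x"
      unfolding eq using y fl p by (auto simp: cyl_def inputs_iff nth_list_update)
    have win: "win (\<phi> \<beta> y) \<beta>' = win y \<beta>'" if "\<beta>' \<in> J" for \<beta>'
    proof -
      have "bucket n (flip \<beta> v) \<in> nbh \<beta>' \<longleftrightarrow> bucket n v \<in> nbh \<beta>'"
      proof (cases "\<beta>' = \<beta>")
        case True
        then show ?thesis using fl p by simp
      next
        case False
        with nbh_disj(1)[OF \<beta> that] fl p(3) show ?thesis by blast
      qed
      then have "bucket n (y[p := flip \<beta> v] ! i) \<in> nbh \<beta>' \<longleftrightarrow> bucket n (y ! i) \<in> nbh \<beta>'" for i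
        using len[OF y] p(1) by (cases "i = p") (auto simp: v_def)
      then show ?thesis unfolding eq win_def by simp
    qed
    have "\<phi> \<beta> (\<phi> \<beta> y) = (\<phi> \<beta> y)[p := flip \<beta> ((\<phi> \<beta> y) ! p)]"
      unfolding \<phi>_def[of \<beta> "\<phi> \<beta> y"] win[OF \<beta>] p_def ..
    also have "\<dots> = y" using fl p len[OF y] by (simp add: eq) (simp add: v_def)
    finally have inv: "\<phi> \<beta> (\<phi> \<beta> y) = y" .
    have rk: "rank_in (\<phi> \<beta> y) (k \<beta>') = rank_in y (k \<beta>') \<longleftrightarrow>
        (bucket n (flip \<beta> v) < \<beta>' \<longleftrightarrow> bucket n v < \<beta>')" if "\<beta>' \<in> J" for \<beta>'
    proof -
      have pk: "p \<noteq> k \<beta>'" using k[OF that] p by auto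
      have "y ! k \<beta>' = x ! k \<beta>'" using y k[OF that] by (simp add: cyl_def)
      then have bk: "bucket n (y ! k \<beta>') = \<beta>'" using k[OF that] by simp
      have ne: "\<beta>' \<notin> nbh \<beta>" using nbh_disj(2)[OF \<beta> that] J[OF \<beta>] by (cases "\<beta>' = \<beta>") (auto simp: nbh_def)
      have "w < y ! k \<beta>' \<longleftrightarrow> bucket n w < \<beta>'" "w \<noteq> y ! k \<beta>'" if "bucket n w \<in> nbh \<beta>" for w
        using less_iff_bucket_less[of n w "y ! k \<beta>'"] bk ne that by auto
      with fl p(3) show ?thesis
        unfolding eq using rank_in_update[of p y "k \<beta>'" "flip \<beta> v"] pk p len[OF y] by (simp add: v_def)
    qed
    have "rank_in (\<phi> \<beta> y) (k \<beta>') = rank_in y (k \<beta>')" if "\<beta>' \<in> J" "\<beta>' \<noteq> \<beta>" for \<beta>'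
    proof -
      have "bucket n (flip \<beta> v) < \<beta>' \<longleftrightarrow> bucket n v < \<beta>'"
      proof -
        have "\<beta> + 3 \<le> \<beta>' \<or> \<beta>' + 3 \<le> \<beta>"
          using gap[OF \<beta> that(1)] gap[OF that(1) \<beta>] that(2) by linarith
        then show ?thesis using fl p(3) by (auto simp: nbh_def)
      qed
      then show ?thesis using rk[OF that(1)] by simp
    qed
    with mem win inv rk[OF \<beta>] fl show ?thesis by auto
  qed
  \<comment> \<open>The flips preserve the windows and hence \<open>S\<close>. On the class
    \<open>S y = T\<close> every \<open>\<beta> \<in> T\<close> has a flip, so the halving argument
    applies class by class.\<close>
  define S where "S y = {\<beta> \<in> J. win y \<beta> \<noteq> {}}" for y
  define E where "E = {y \<in> cyl t x. \<forall>\<beta>\<in>J. rank_in y (k \<beta>) = r \<beta>}"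
  have half: "real (card {y \<in> E. S y = T}) \<le> (1/2) ^ card T * card {y \<in> cyl t x. S y = T}"
    if T: "T \<in> Pow J" for T
  proof -
    let ?C = "{y \<in> cyl t x. S y = T}"
    have "2 ^ card T * card {y \<in> ?C. \<forall>\<beta>\<in>T. rank_in y (k \<beta>) = r \<beta>} \<le> card ?C"
    proof (rule card_constraints_le[where \<phi> = \<phi>])
      fix \<beta> y assume a: "\<beta> \<in> T" "y \<in> ?C"
      then have st: "\<beta> \<in> J" "y \<in> cyl t x" "win y \<beta> \<noteq> {}" by (auto simp: S_def)
      show "\<phi> \<beta> y \<in> ?C" using step[OF st] a by (auto simp: S_def)
      show "rank_in (\<phi> \<beta> y) (k \<beta>) \<noteq> r \<beta>" if "rank_in y (k \<beta>) = r \<beta>"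
        using step[OF st] that by simp
    next
      fix \<beta> assume a: "\<beta> \<in> T"
      show "inj_on (\<phi> \<beta>) ?C"
      proof (rule inj_on_inverseI)
        fix y assume "y \<in> ?C"
        with a have st: "\<beta> \<in> J" "y \<in> cyl t x" "win y \<beta> \<noteq> {}" by (auto simp: S_def)
        show "\<phi> \<beta> (\<phi> \<beta> y) = y" using step[OF st] by simp
      qed
    next
      fix \<beta>' \<beta> y assume a: "\<beta>' \<in> T" "\<beta> \<in> T" "\<beta>' \<noteq> \<beta>" "y \<in> ?C"
      then have st: "\<beta> \<in> J" "y \<in> cyl t x" "win y \<beta> \<noteq> {}" by (auto simp: S_def)
      show "(rank_in (\<phi> \<beta> y) (k \<beta>') = r \<beta>') = (rank_in y (k \<beta>') = r \<beta>')"
        using step[OF st] a T by auto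
    qed (use T finJ finite_subset in auto)
    moreover have "card {y \<in> E. S y = T} \<le> card {y \<in> ?C. \<forall>\<beta>\<in>T. rank_in y (k \<beta>) = r \<beta>}"
      by (rule card_mono) (use T in \<open>auto simp: E_def\<close>)
    ultimately have "2 ^ card T * card {y \<in> E. S y = T} \<le> card ?C"
      by (meson le_trans mult_le_mono2)
    then show ?thesis by (rule real_le_half_power_mult)
  qed
  have fE: "finite E" by (simp add: E_def)
  have SJ: "S ` A \<subseteq> Pow J" for A by (auto simp: S_def)
  \<comment> \<open>Each of the at least \<open>n / 2\<close> unread contents is barred from
    \<open>2 * card T\<close> buckets, which gives
    \<open>(1 - 2 * card T / n) ^ (n / 2) \<le> exp (- card T)\<close>.\<close>
  have avoid: "real (card {y \<in> cyl t x. \<forall>\<beta>\<in>T. win y \<beta> = {}}) \<le> (1/2) ^ card T * card (cyl t x)"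
    if T: "T \<subseteq> J" for T
  proof -
    let ?B = "\<Union>\<beta>\<in>T. nbh \<beta>" and ?s = "card (seen t x)"
    let ?A = "{v \<in> {1..n^2}. bucket n v \<in> {..<n} - ?B}"
    have fT: "finite T" using T finJ finite_subset by blast
    have B: "?B \<subseteq> {..<n}" using T J by (force simp: nbh_def)
    have "card ?B = (\<Sum>\<beta>\<in>T. card (nbh \<beta>))"
      by (rule card_UN_disjoint) (use fT nbh_disj(1) T in \<open>auto simp: nbh_def[of "_"]\<close>)
    also have "\<dots> = 2 * card T" using T J by (simp add: nbh_def)
    finally have cB: "card ?B = 2 * card T" .
    then have T2: "2 * card T \<le> n" using card_mono[OF _ B] by simp
    have cA: "card ?A = n * (n - 2 * card T)"
      by (subst card_bucket_vimage) (use B cB in \<open>auto simp: card_Diff_subset finite_subset\<close>)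
    have "{y \<in> cyl t x. \<forall>\<beta>\<in>T. win y \<beta> = {}} = {y \<in> cyl t x. \<forall>i\<in>{..<n} - seen t x. y ! i \<in> ?A}"
    proof (intro Collect_cong conj_cong refl)
      fix y assume y: "y \<in> cyl t x"
      have "y ! i \<in> {1..n^2} \<and> bucket n (y ! i) < n" if "i < n" for i
      proof -
        have "y ! i \<in> {1..N}" using y that by (simp add: cyl_def inputs_iff)
        then show ?thesis using bucket_less unfolding N by blast
      qed
      then show "(\<forall>\<beta>\<in>T. win y \<beta> = {}) = (\<forall>i\<in>{..<n} - seen t x. y ! i \<in> ?A)"
        unfolding win_def by blast
    qed
    moreover have "?A \<subseteq> {1..N}" unfolding N by blast
    ultimately have "card {y \<in> cyl t x. \<forall>\<beta>\<in>T. win y \<beta> = {}} = (n * (n - 2 * card T)) ^ (n - ?s)"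
      using card_cyl_in[OF x, of ?A t] cA by (simp only:)
    then have "real (card {y \<in> cyl t x. \<forall>\<beta>\<in>T. win y \<beta> = {}}) = (n * (n - 2 * card T)) ^ (n - ?s)"
      by (simp only:)
    also have "\<dots> = real (n * (n - 2 * card T)) ^ (n - ?s)" by (rule of_nat_power)
    also have "real (n * (n - 2 * card T)) = (1 - 2 * card T / n) * real n ^ 2"
      using T2 n by (simp add: of_nat_diff left_diff_distrib power2_eq_square right_diff_distrib)
    also have "\<dots> ^ (n - ?s) = (1 - 2 * card T / n) ^ (n - ?s) * (real n ^ 2) ^ (n - ?s)"
      by (rule power_mult_distrib)
    also have "(1 - 2 * card T / n) ^ (n - ?s) \<le> exp (- 2 * card T / n) ^ (n - ?s)"
      using T2 n exp_ge_add_one_self[of "- 2 * card T / n"] by (intro power_mono) (auto simp: field_simps)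
    also have "\<dots> = exp (- (2 * (n - ?s) / n * card T))"
      by (simp add: exp_of_nat_mult[symmetric] mult_ac)
    also have "\<dots> \<le> exp (- real (card T))"
    proof -
      have "real n \<le> 2 * real (n - ?s)" using few by linarith
      then have "1 \<le> 2 * (n - ?s) / n" using n by simp
      then have "1 * real (card T) \<le> 2 * (n - ?s) / n * card T" by (rule mult_right_mono) simp
      then show ?thesis by (simp only: exp_le_cancel_iff neg_le_iff_le mult_1)
    qed
    also have "\<dots> = exp (- 1) ^ card T" using exp_of_nat_mult[of "card T" "- 1 :: real"] by simp
    also have "\<dots> \<le> (1/2) ^ card T"
      using exp_ge_add_one_self[of 1] by (intro power_mono) (auto simp: exp_minus field_simps)
    also have "(real n ^ 2) ^ (n - ?s) = card (cyl t x)" using card_cyl[OF x, of t] N by simp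
    finally show ?thesis by (simp add: mult_right_mono)
  qed
  have "real (card E) = (\<Sum>T\<in>Pow J. real (card {y \<in> E. S y = T}))"
    using sum.group[OF fE _ SJ, of "\<lambda>_. 1::real"] finJ by simp
  also have "\<dots> \<le> (\<Sum>T\<in>Pow J. (1/2) ^ card T * card {y \<in> cyl t x. S y = T})"
    by (rule sum_mono) (rule half)
  also have "\<dots> = (\<Sum>T\<in>Pow J. \<Sum>y\<in>{y \<in> cyl t x. S y = T}. (1/2) ^ card (S y))"
    by (intro sum.cong) auto
  also have "\<dots> = (\<Sum>y\<in>cyl t x. (1/2) ^ card (S y))"
    by (rule sum.group) (use finJ SJ in auto)
  \<comment> \<open>A bucket contributes the factor 1 if its window is empty and 1/2 otherwise, that
    is, 1/2 plus half an indicator. Expanding the product leaves only events of the form that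
    \<open>avoid\<close> bounds, without any independence.\<close>
  also have "\<dots> = (\<Sum>y\<in>cyl t x. \<Sum>T\<in>Pow J. (1/2) ^ card J * of_bool (\<forall>\<beta>\<in>T. win y \<beta> = {}))"
  proof (rule sum.cong[OF refl])
    fix y assume "y \<in> cyl t x"
    have "(1/2) ^ card (S y) = (\<Prod>\<beta>\<in>J. if win y \<beta> \<noteq> {} then 1/2 else 1 :: real)"
      unfolding S_def using finJ by (simp add: prod.If_cases Int_def)
    also have "\<dots> = (\<Prod>\<beta>\<in>J. 1/2 * of_bool (win y \<beta> = {}) + 1/2)"
      by (rule prod.cong) auto
    also have "\<dots> = (\<Sum>T\<in>Pow J. (\<Prod>\<beta>\<in>T. 1/2 * of_bool (win y \<beta> = {})) * (\<Prod>\<beta>\<in>J-T. 1/2))"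
      by (rule prod_add[OF finJ])
    also have "\<dots> = (\<Sum>T\<in>Pow J. (1/2) ^ card J * of_bool (\<forall>\<beta>\<in>T. win y \<beta> = {}))"
    proof (rule sum.cong[OF refl])
      fix T assume T: "T \<in> Pow J"
      then have fT: "finite T" using finJ finite_subset by auto
      have o: "(\<Prod>\<beta>\<in>T. of_bool (win y \<beta> = {})) = (of_bool (\<forall>\<beta>\<in>T. win y \<beta> = {}) :: real)"
        using fT by (induction T) auto
      have p: "(1/2 :: real) ^ card T * (1/2) ^ card (J - T) = (1/2) ^ card J"
        using T finJ fT by (simp add: card_Diff_subset card_mono power_add[symmetric])
      have assoc: "a * d * b = a * b * d" for a b d :: real by simp
      show "(\<Prod>\<beta>\<in>T. 1/2 * of_bool (win y \<beta> = {})) * (\<Prod>\<beta>\<in>J-T. 1/2) =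
          ((1/2) ^ card J * of_bool (\<forall>\<beta>\<in>T. win y \<beta> = {}) :: real)"
        unfolding prod.distrib prod_constant o p[symmetric] by (rule assoc)
    qed
    finally show "(1/2) ^ card (S y) = (\<Sum>T\<in>Pow J. (1/2) ^ card J * of_bool (\<forall>\<beta>\<in>T. win y \<beta> = {}) :: real)" .
  qed
  also have "\<dots> = (\<Sum>T\<in>Pow J. \<Sum>y\<in>cyl t x. (1/2) ^ card J * of_bool (\<forall>\<beta>\<in>T. win y \<beta> = {}))"
    by (rule sum.swap)
  also have "\<dots> = (\<Sum>T\<in>Pow J. (1/2) ^ card J * card {y \<in> cyl t x. \<forall>\<beta>\<in>T. win y \<beta> = {}})"
    unfolding sum_distrib_left[symmetric] by (simp add: of_bool_def sum.If_cases Int_def)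
  also have "\<dots> \<le> (\<Sum>T\<in>Pow J. (1/2) ^ card J * ((1/2) ^ card T * card (cyl t x)))"
    using avoid by (intro sum_mono mult_left_mono) auto
  also have "\<dots> = (1/2) ^ card J * (\<Sum>T\<in>Pow J. (1/2) ^ card T) * card (cyl t x)"
    by (simp add: sum_distrib_left sum_distrib_right mult_ac)
  \<comment> \<open>Binomial expansion over subsets; each bucket accounts for
    \<open>1/2 * (1 + 1/2) = 3/4\<close>.\<close>
  also have "(\<Sum>T\<in>Pow J. (1/2 :: real) ^ card T) = (3/2) ^ card J"
    using prod_add[OF finJ, of "\<lambda>_. 1/2 :: real" "\<lambda>_. 1"] by simp
  also have "(1/2 :: real) ^ card J * (3/2) ^ card J = (3/4) ^ card J"
    by (simp add: power_mult_distrib[symmetric])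
  finally show ?thesis by (simp add: E_def)
qed

end

section \<open>Correct items of a single block\<close>

text \<open>The buckets 0 and \<open>n - 1\<close> lack a neighbour and are dropped, hence the
  \<open>+ 2\<close>. Some residue class modulo 3 holds a third of the rest, and distinct members of
  one class differ by at least 3.\<close>

lemma spread_subset_exists:
  fixes B :: "nat set"
  assumes "B \<subseteq> {..<n}" "3 * q + 2 \<le> card B"
  shows "\<exists>J\<subseteq>B. card J = q \<and> (\<forall>\<beta>\<in>J. 0 < \<beta> \<and> \<beta> + 1 < n) \<and>
    (\<forall>\<beta>\<in>J. \<forall>\<beta>'\<in>J. \<beta> < \<beta>' \<longrightarrow> \<beta> + 3 \<le> \<beta>')"
proof -
  have fB: "finite B" using finite_subset[OF assms(1)] by simp
  define C where "C j = {\<beta> \<in> B - {0, n - 1}. \<beta> mod 3 = j}" for j :: nat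
  have fC: "finite (C j)" for j using fB by (simp add: C_def)
  have "\<exists>j<3. q \<le> card (C j)"
  proof (rule ccontr)
    assume "\<not> ?thesis"
    then have small: "card (C 0) < q" "card (C 1) < q" "card (C 2) < q" by (simp_all add: not_le)
    have "B - {0, n - 1} \<subseteq> C 0 \<union> C 1 \<union> C 2" by (auto simp: C_def)
    then have "card (B - {0, n - 1}) \<le> card (C 0 \<union> C 1 \<union> C 2)"
      using fC by (intro card_mono) auto
    also have "\<dots> \<le> card (C 0) + card (C 1) + card (C 2)"
      by (meson add_mono card_Un_le le_refl le_trans)
    finally have "card (B - {0, n - 1}) < 3 * q" using small by linarith
    moreover have "card B - card {0, n - 1} \<le> card (B - {0, n - 1})"
      by (rule diff_card_le_card_Diff) simp
    moreover have "card {0, n - 1} \<le> 2" by (simp add: card_insert_if)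
    ultimately show False using assms(2) by linarith
  qed
  then obtain j J where J: "J \<subseteq> C j" "card J = q" by (meson obtain_subset_with_card_n)
  have "\<beta> + 3 \<le> \<beta>'" if "\<beta> \<in> J" "\<beta>' \<in> J" "\<beta> < \<beta>'" for \<beta> \<beta>'
  proof -
    have "\<beta> mod 3 = \<beta>' mod 3" using J(1) that by (auto simp: C_def)
    with that(3) show ?thesis by presburger
  qed
  moreover have "0 < \<beta> \<and> \<beta> + 1 < n" if "\<beta> \<in> J" for \<beta>
    using subsetD[OF J(1) that] assms(1) by (force simp: C_def)
  moreover have "J \<subseteq> B" using J(1) by (auto simp: C_def)
  ultimately show ?thesis using J(2) by blast
qed

context adaptive_reading
begin

text \<open>Markov's inequality for the weight \<open>8 ^ k\<close>, with a union bound over the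
  \<open>n ^ g\<close> lists of \<open>g\<close> buckets. Lists instead of sets make this count
  exact and admit repetitions, so fewer than \<open>g\<close> buckets are covered too.\<close>

lemma card_concentrated_le:
  assumes N: "N = n^2" and n: "n > 0" and h: "2 * h \<le> n"
  shows "real (card {x \<in> inputs n N. \<exists>l. set l \<subseteq> {..<n} \<and> length l = g \<and>
      m \<le> card {i \<in> seen h x. bucket n (x ! i) \<in> set l}}) \<le> real n ^ g * (2 ^ (7 * g) / 8 ^ m) * real N ^ n"
proof -
  define L where "L = {l. set l \<subseteq> {..<n} \<and> length l = g}"
  define A where "A l = {v \<in> {1..n^2}. bucket n v \<in> set l}" for l
  define F where "F l = {x \<in> inputs n N. m \<le> card {i \<in> seen h x. x ! i \<in> A l}}" for l
  have fL: "finite L" "card L = n ^ g"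
    using finite_lists_length_eq[of "{..<n}" g] card_lists_length_eq[of "{..<n}" g] by (simp_all add: L_def)
  have F: "real (card (F l)) \<le> 2 ^ (7 * g) / 8 ^ m * real N ^ n" if l: "l \<in> L" for l
  proof -
    have "8 ^ m * real (card (F l)) = (\<Sum>x\<in>F l. 8 ^ m)" by simp
    also have "\<dots> \<le> (\<Sum>x\<in>F l. 8 ^ card {i \<in> seen h x. x ! i \<in> A l})"
      by (intro sum_mono power_increasing) (auto simp: F_def)
    also have "\<dots> \<le> (\<Sum>x\<in>inputs n N. 8 ^ card {i \<in> seen h x. x ! i \<in> A l})"
      by (intro sum_mono2) (auto simp: F_def)
    also have "\<dots> \<le> (1 + 7 * card (A l) / N) ^ h * real N ^ n"
      by (rule sum_power_read_le) (use N n in \<open>auto simp: A_def\<close>)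
    \<comment> \<open>From \<open>h \<le> n / 2\<close> the exponent is at most
      \<open>7 * g / 2\<close>, and \<open>exp (1/2) \<le> 2\<close>.\<close>
    also have "(1 + 7 * card (A l) / N) ^ h \<le> 2 ^ (7 * g)"
    proof -
      have "card (A l) = n * card (set l)"
        unfolding A_def by (rule card_bucket_vimage) (use l in \<open>simp add: L_def\<close>)
      also have "\<dots> \<le> n * g" using l card_length[of l] by (simp add: L_def)
      finally have "real (card (A l)) \<le> real n * real g" by (simp only: of_nat_le_iff flip: of_nat_mult)
      then have "7 * card (A l) / N \<le> 7 * g / n"
        using n by (simp add: N field_simps power2_eq_square)
      then have "1 + 7 * card (A l) / N \<le> exp (7 * g / n)"
        using exp_ge_add_one_self[of "7 * g / n"] by linarith
      then have "(1 + 7 * card (A l) / N) ^ h \<le> exp (7 * g / n) ^ h"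
        by (intro power_mono) auto
      also have "\<dots> = exp (h * (7 * g / n))" by (rule exp_of_nat_mult[symmetric])
      also have "\<dots> \<le> exp (real (7 * g) * (1/2))"
        using h n mult_right_mono[of "real h" "n / 2" "7 * g / n"] by simp
      also have "\<dots> = exp (1/2) ^ (7 * g)" by (rule exp_of_nat_mult)
      also have "\<dots> \<le> 2 ^ (7 * g)"
        using exp_half_le2 by (intro power_mono) auto
      finally show ?thesis .
    qed
    finally show ?thesis by (simp add: field_simps mult_right_mono)
  qed
  have "{x \<in> inputs n N. \<exists>l. set l \<subseteq> {..<n} \<and> length l = g \<and>
      m \<le> card {i \<in> seen h x. bucket n (x ! i) \<in> set l}} \<subseteq> (\<Union>l\<in>L. F l)"
  proof
    fix x assume "x \<in> {x \<in> inputs n N. \<exists>l. set l \<subseteq> {..<n} \<and> length l = g \<and>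
      m \<le> card {i \<in> seen h x. bucket n (x ! i) \<in> set l}}"
    then obtain l where x: "x \<in> inputs n N" and l: "l \<in> L" "m \<le> card {i \<in> seen h x. bucket n (x ! i) \<in> set l}"
      by (auto simp: L_def)
    have "{i \<in> seen h x. bucket n (x ! i) \<in> set l} = {i \<in> seen h x. x ! i \<in> A l}"
      using seen_subset[OF x, of h] x N by (auto simp: A_def inputs_iff)
    with x l show "x \<in> (\<Union>l\<in>L. F l)" by (auto simp: F_def)
  qed
  then have "card {x \<in> inputs n N. \<exists>l. set l \<subseteq> {..<n} \<and> length l = g \<and>
      m \<le> card {i \<in> seen h x. bucket n (x ! i) \<in> set l}} \<le> card (\<Union>l\<in>L. F l)"
    by (rule card_mono[rotated]) (use fL in \<open>auto simp: F_def\<close>)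
  also have "\<dots> \<le> (\<Sum>l\<in>L. card (F l))" by (rule card_UN_le[OF fL(1)])
  finally have "card {x \<in> inputs n N. \<exists>l. set l \<subseteq> {..<n} \<and> length l = g \<and>
      m \<le> card {i \<in> seen h x. bucket n (x ! i) \<in> set l}} \<le> (\<Sum>l\<in>L. card (F l))" .
  then have "real (card {x \<in> inputs n N. \<exists>l. set l \<subseteq> {..<n} \<and> length l = g \<and>
      m \<le> card {i \<in> seen h x. bucket n (x ! i) \<in> set l}}) \<le> (\<Sum>l\<in>L. real (card (F l)))"
    by (simp only: of_nat_le_iff flip: of_nat_sum)
  also have "\<dots> \<le> (\<Sum>l\<in>L. 2 ^ (7 * g) / 8 ^ m * real N ^ n)" by (rule sum_mono) (rule F)
  finally show ?thesis using fL(2) by simp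
qed

text \<open>By \<open>it_cong\<close> the items are constant on each cylinder, so they are guesses
  made from the contents read. Either many concern unread positions (\<open>E1\<close>), or the read
  ones are spread over many buckets (\<open>E2\<close>), or many read contents share few buckets
  (\<open>E3\<close>).\<close>

lemma card_correct_items_le:
  fixes it :: "nat list \<Rightarrow> item set"
  assumes N: "N = n^2" and n: "n \<ge> 2 ^ 15" and h: "2 * h \<le> n" and lam: "n \<le> 2 ^ lg"
    and it_cong: "\<And>x y. x \<in> inputs n N \<Longrightarrow> y \<in> cyl h x \<Longrightarrow> it y = it x"
  shows "real (card {x \<in> inputs n N. distinct x \<and> it x \<subseteq> {(i, rank_in x i) |i. i < n} \<and>
      12 * lg * q \<le> card (it x)}) \<le> real n ^ 3 * (3/4) ^ q * real N ^ n"
proof -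
  define E where "E = {x \<in> inputs n N. distinct x \<and> it x \<subseteq> {(i, rank_in x i) |i. i < n} \<and>
      12 * lg * q \<le> card (it x)}"
  define D where "D x = fst ` it x" for x
  \<comment> \<open>The threshold is \<open>2 * m\<close>, so \<open>m\<close> of the positions are
    unread or \<open>m\<close> are read. Unread ones form \<open>3 * lg * q\<close> pairs;
    \<open>g\<close> is what \<open>spread_subset_exists\<close> asks for \<open>q\<close>
    buckets.\<close>
  define m where "m = 6 * lg * q"
  define g where "g = 3 * q + 2"
  define bk where "bk x = (\<lambda>i. bucket n (x ! i)) ` (D x \<inter> seen h x)" for x
  define E1 where "E1 = {x \<in> E. m \<le> card (D x - seen h x)}"
  define E2 where "E2 = {x \<in> E. g \<le> card (bk x)}"
  define E3 where "E3 = {x \<in> inputs n N. \<exists>l. set l \<subseteq> {..<n} \<and> length l = g \<and>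
      m \<le> card {i \<in> seen h x. bucket n (x ! i) \<in> set l}}"
  have n0: "n > 0" using n by (rule less_le_trans[rotated]) simp
  have lam15: "lg \<ge> 15"
  proof -
    have "(2::nat) ^ 15 \<le> 2 ^ lg" using n lam by (rule order_trans)
    then show ?thesis by (rule power_le_imp_le_exp[rotated]) simp
  qed
  have Ein: "x \<in> inputs n N" if "x \<in> E" for x using that by (simp add: E_def)
  have Dn: "D x \<subseteq> {..<n}" if "x \<in> E" for x using that by (auto simp: D_def E_def)
  then have fD: "finite (D x)" if "x \<in> E" for x using that finite_subset by blast
  have cD: "2 * m \<le> card (D x)" if "x \<in> E" for x
  proof -
    have "inj_on fst {(i, rank_in x i) |i. i < n}" by (auto simp: inj_on_def)
    then have "inj_on fst (it x)" by (rule inj_on_subset) (use that in \<open>simp add: E_def\<close>)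
    then have "card (D x) = card (it x)" by (simp add: D_def card_image)
    with that show ?thesis by (simp add: E_def m_def)
  qed
  have Dcong: "D y = D x" "\<And>i. i \<in> D x \<Longrightarrow> rank_in y i = rank_in x i"
    if "x \<in> E" "y \<in> E" "y \<in> cyl h x" for x y
  proof -
    have eq: "it y = it x" using it_cong Ein that by blast
    then show "D y = D x" by (simp add: D_def)
    fix i assume "i \<in> D x"
    then obtain v where v: "(i, v) \<in> it x" by (auto simp: D_def)
    have "v = rank_in x i" "v = rank_in y i" using v that eq by (auto simp: E_def)
    then show "rank_in y i = rank_in x i" by simp
  qed
  have fE: "finite E" by (rule finite_subset[OF _ finite_inputs[of n N]]) (auto simp: E_def)
  have "E \<subseteq> E1 \<union> E2 \<union> E3"
  proof
    fix x assume x: "x \<in> E"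
    show "x \<in> E1 \<union> E2 \<union> E3"
    proof (rule ccontr)
      assume "\<not> ?thesis"
      then have not: "card (D x - seen h x) < m" "card (bk x) < g" "x \<notin> E3"
        using x by (auto simp: E1_def E2_def)
      have "card (D x) = card (D x \<inter> seen h x) + card (D x - seen h x)"
        using card_Int_Diff[OF fD[OF x]] .
      then have mD: "m \<le> card (D x \<inter> seen h x)" using cD[OF x] not(1) by linarith
      have fbk: "finite (bk x)" by (simp add: bk_def)
      have bkn: "bk x \<subseteq> {..<n}"
        using Dn[OF x] Ein[OF x] N bucket_less by (auto simp: bk_def inputs_iff)
      obtain ds where ds: "set ds = bk x" "distinct ds"
        using finite_distinct_list[OF fbk] by auto
      \<comment> \<open>Bucket 0 pads the list to length exactly \<open>g\<close>, as
        \<open>E3\<close> requires.\<close>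
      define l where "l = ds @ replicate (g - card (bk x)) 0"
      have "length ds = card (bk x)" using ds distinct_card by metis
      then have "length l = g" using not(2) by (simp add: l_def)
      moreover have "set l \<subseteq> {..<n}" using ds(1) bkn n0 by (auto simp: l_def)
      moreover have "D x \<inter> seen h x \<subseteq> {i \<in> seen h x. bucket n (x ! i) \<in> set l}"
        by (auto simp: l_def ds(1) bk_def)
      then have "card (D x \<inter> seen h x) \<le> card {i \<in> seen h x. bucket n (x ! i) \<in> set l}"
        by (intro card_mono) auto
      ultimately have "x \<in> E3" unfolding E3_def using Ein[OF x] mD by (auto intro!: exI[of _ l])
      with not(3) show False ..
    qed
  qed
  moreover have "finite E1" "finite E2" "finite E3" using fE by (auto simp: E1_def E2_def E3_def)
  ultimately have "card E \<le> card (E1 \<union> E2 \<union> E3)" by (intro card_mono) auto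
  also have "\<dots> \<le> card E1 + card E2 + card E3"
    by (meson add_mono card_Un_le le_refl le_trans)
  finally have split: "real (card E) \<le> real (card E1) + real (card E2) + real (card E3)"
    by linarith
  have "real (card E1) \<le> (1/2) ^ (3 * lg * q) * card (inputs n N)"
  proof (rule card_le_if_card_cyl_le[where t = h])
    show "E1 \<subseteq> inputs n N" using Ein by (auto simp: E1_def)
    fix x assume x: "x \<in> E1"
    then have xE: "x \<in> E" by (simp add: E1_def)
    let ?R = "{y \<in> cyl h x. distinct y \<and> (\<forall>i\<in>D x - seen h x. rank_in y i = rank_in x i)}"
    have "2 ^ (3 * lg * q) * card ?R \<le> card (cyl h x)"
      by (rule card_ranks_unread_le) (use x Ein[OF xE] Dn[OF xE] in \<open>auto simp: E1_def m_def\<close>)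
    moreover have "E1 \<inter> cyl h x \<subseteq> ?R"
      using Dcong(2)[OF xE] by (auto simp: E1_def) (auto simp: E_def)
    then have "card (E1 \<inter> cyl h x) \<le> card ?R" by (rule card_mono[rotated]) simp
    ultimately have "2 ^ (3 * lg * q) * card (E1 \<inter> cyl h x) \<le> card (cyl h x)"
      by (meson le_trans mult_le_mono2)
    then show "real (card (E1 \<inter> cyl h x)) \<le> (1/2) ^ (3 * lg * q) * card (cyl h x)"
      by (rule real_le_half_power_mult)
  qed simp
  also have "(1/2 :: real) ^ (3 * lg * q) \<le> (1/2) ^ q"
    using lam15 by (intro power_decreasing) auto
  also have "(1/2 :: real) ^ q \<le> (3/4) ^ q" by (intro power_mono) auto
  finally have b1: "real (card E1) \<le> (3/4) ^ q * real N ^ n"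
    by (simp add: card_inputs mult_right_mono)
  have "real (card E2) \<le> (3/4) ^ q * card (inputs n N)"
  proof (rule card_le_if_card_cyl_le[where t = h])
    show "E2 \<subseteq> inputs n N" using Ein by (auto simp: E2_def)
    fix x assume x: "x \<in> E2"
    then have xE: "x \<in> E" by (simp add: E2_def)
    have "bk x \<subseteq> {..<n}"
      using Dn[OF xE] Ein[OF xE] N bucket_less by (auto simp: bk_def inputs_iff)
    moreover have "3 * q + 2 \<le> card (bk x)" using x by (simp add: E2_def g_def)
    ultimately have "\<exists>J\<subseteq>bk x. card J = q \<and> (\<forall>\<beta>\<in>J. 0 < \<beta> \<and> \<beta> + 1 < n) \<and>
        (\<forall>\<beta>\<in>J. \<forall>\<beta>'\<in>J. \<beta> < \<beta>' \<longrightarrow> \<beta> + 3 \<le> \<beta>')"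
      by (rule spread_subset_exists)
    then obtain J where J: "J \<subseteq> bk x \<and> card J = q \<and> (\<forall>\<beta>\<in>J. 0 < \<beta> \<and> \<beta> + 1 < n) \<and>
        (\<forall>\<beta>\<in>J. \<forall>\<beta>'\<in>J. \<beta> < \<beta>' \<longrightarrow> \<beta> + 3 \<le> \<beta>')"
      by (rule exE)
    then have "\<forall>\<beta>\<in>J. \<exists>i. i \<in> D x \<inter> seen h x \<and> bucket n (x ! i) = \<beta>"
      by (auto simp: bk_def)
    from bchoice[OF this] obtain k
      where k: "\<forall>\<beta>\<in>J. k \<beta> \<in> D x \<inter> seen h x \<and> bucket n (x ! k \<beta>) = \<beta>"
      by (rule exE)
    let ?R = "{y \<in> cyl h x. \<forall>\<beta>\<in>J. rank_in y (k \<beta>) = rank_in x (k \<beta>)}"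
    have "card ?R \<le> (3/4) ^ card J * card (cyl h x)"
      by (rule card_ranks_spread_le[OF N Ein[OF xE]])
        (use J k h card_seen_le[of h x] in \<open>simp_all\<close>)
    moreover have "E2 \<inter> cyl h x \<subseteq> ?R"
      using Dcong(2)[OF xE] k by (auto simp: E2_def)
    then have "card (E2 \<inter> cyl h x) \<le> card ?R" by (rule card_mono[rotated]) simp
    ultimately show "real (card (E2 \<inter> cyl h x)) \<le> (3/4) ^ q * card (cyl h x)"
      using J by simp
  qed simp
  then have b2: "real (card E2) \<le> (3/4) ^ q * real N ^ n" by (simp add: card_inputs)
  \<comment> \<open>Here \<open>8 ^ m\<close> is 2 to the power \<open>18 * lg * q\<close>. The
    choices of buckets use up \<open>3 * lg * q\<close> of the exponent; the remaining
    \<open>15 * lg * q\<close> covers \<open>21 * q\<close> and one more \<open>q\<close> for the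
    decay, by \<open>lam15\<close>. The 2 in \<open>g\<close> leaves over
    \<open>n ^ 2 * 2 ^ 14\<close>.\<close>
  have "real n ^ g * (2 ^ (7 * g) / 8 ^ m) \<le> real n ^ 2 * 2 ^ 14 * (3/4) ^ q"
  proof -
    have "real n \<le> 2 ^ lg" using of_nat_mono[OF lam, where ?'a = real] by simp
    then have "real n ^ (3 * q) \<le> (2 ^ lg) ^ (3 * q)" by (intro power_mono) auto
    then have "real n ^ (3 * q) * 2 ^ (21 * q) \<le> 2 ^ (3 * lg * q + 21 * q)"
      by (simp add: power_mult[symmetric] power_add mult_ac)
    also have "\<dots> * 2 ^ q = 2 ^ (3 * lg * q + 22 * q)"
      by (simp add: power_add[symmetric])
    then have "2 ^ (3 * lg * q + 21 * q) = (2 :: real) ^ (3 * lg * q + 22 * q) / 2 ^ q"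
      by (simp add: field_simps)
    also have "(2 :: real) ^ (3 * lg * q + 22 * q) \<le> 2 ^ (3 * m)"
    proof (rule power_increasing)
      have "22 * q \<le> (15 * lg) * q" using lam15 by (intro mult_right_mono) auto
      then show "3 * lg * q + 22 * q \<le> 3 * m" by (simp add: m_def)
    qed simp
    also have "(2 :: real) ^ (3 * m) = 8 ^ m" by (simp add: power_mult)
    finally have "real n ^ (3 * q) * 2 ^ (21 * q) \<le> 8 ^ m * (1/2) ^ q"
      by (simp add: power_one_over field_simps divide_right_mono)
    also have "\<dots> \<le> 8 ^ m * (3/4) ^ q" by (intro mult_left_mono power_mono) auto
    finally have *: "real n ^ (3 * q) * 2 ^ (21 * q) \<le> 8 ^ m * (3/4) ^ q" .
    have "real n ^ g * 2 ^ (7 * g) = (real n ^ (3 * q) * 2 ^ (21 * q)) * (real n ^ 2 * 2 ^ 14)"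
      by (simp add: g_def power_add algebra_simps power2_eq_square)
    also have "\<dots> \<le> (8 ^ m * (3/4) ^ q) * (real n ^ 2 * 2 ^ 14)"
      by (rule mult_right_mono[OF *]) simp
    finally show ?thesis by (simp add: field_simps power2_eq_square)
  qed
  then have "real n ^ g * (2 ^ (7 * g) / 8 ^ m) * real N ^ n \<le> real n ^ 2 * 2 ^ 14 * (3/4) ^ q * real N ^ n"
    by (rule mult_right_mono) simp
  then have b3: "real (card E3) \<le> real n ^ 2 * 2 ^ 14 * ((3/4) ^ q * real N ^ n)"
    using card_concentrated_le[OF N n0 h, of g m] unfolding E3_def by (simp add: mult.assoc)
  \<comment> \<open>The 2 stands for \<open>E1\<close> and \<open>E2\<close>; the rest comes from
    \<open>E3\<close>.\<close>
  have "(2 + real n ^ 2 * 2 ^ 14) * ((3/4) ^ q * real N ^ n) \<le> real n ^ 3 * ((3/4) ^ q * real N ^ n)"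
  proof (rule mult_right_mono)
    have "1 \<le> real n ^ 2" using n0 by simp
    moreover have "2 ^ 15 * real n ^ 2 \<le> real n * real n ^ 2"
      using n by (intro mult_right_mono) (simp_all flip: of_nat_le_iff)
    ultimately show "2 + real n ^ 2 * 2 ^ 14 \<le> real n ^ 3"
      by (simp add: power3_eq_cube power2_eq_square)
  qed simp
  with split b1 b2 b3 show ?thesis unfolding E_def[symmetric] by (simp add: algebra_simps power2_eq_square)
qed

end

section \<open>Blocks of a branching program\<close>

definition read_at :: "bprog \<Rightarrow> nat \<Rightarrow> nat \<Rightarrow> nat list \<Rightarrow> nat option" where
  "read_at P v t x = Option.bind (walk P x v t) (query P)"

text \<open>The block starts at \<open>v\<close> whether or not the run on \<open>x\<close> from the
  root visits \<open>v\<close>. So \<open>v\<close> can be fixed before the input is drawn.\<close>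

definition block_items :: "bprog \<Rightarrow> nat \<Rightarrow> nat \<Rightarrow> nat list \<Rightarrow> item set" where
  "block_items P v h x = (\<Union>t<h. set (emitted P x v t))"

lemma consistent_edge_cong:
  "(\<And>i. query P u = Some i \<Longrightarrow> y ! i = x ! i) \<Longrightarrow> consistent_edge P y u = consistent_edge P x u"
  unfolding consistent_edge_def by (cases "query P u") auto

lemma walk_cong:
  "(\<And>s i. s < t \<Longrightarrow> read_at P v s x = Some i \<Longrightarrow> y ! i = x ! i) \<Longrightarrow> walk P y v t = walk P x v t"
proof (induction t)
  case (Suc t)
  have IH: "walk P y v t = walk P x v t" by (rule Suc.IH) (rule Suc.prems, auto)
  show ?case
  proof (cases "walk P x v t")
    case (Some u)
    have "consistent_edge P y u = consistent_edge P x u"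
      by (rule consistent_edge_cong) (use Suc.prems[of t] Some in \<open>auto simp: read_at_def\<close>)
    then show ?thesis using IH Some by simp
  qed (use IH in simp)
qed simp

text \<open>The items at time \<open>t\<close> sit on the edge taken at time \<open>t\<close>, so
  they also depend on the content read at that time: one reading more than in
  \<open>walk_cong\<close>.\<close>

lemma emitted_cong:
  assumes "\<And>s i. s < Suc t \<Longrightarrow> read_at P v s x = Some i \<Longrightarrow> y ! i = x ! i"
  shows "emitted P y v t = emitted P x v t"
proof -
  have IH: "walk P y v t = walk P x v t" by (rule walk_cong) (rule assms, auto)
  show ?thesis
  proof (cases "walk P x v t")
    case (Some u)
    have "consistent_edge P y u = consistent_edge P x u"
      by (rule consistent_edge_cong) (use assms[of t] Some in \<open>auto simp: read_at_def\<close>)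
    then show ?thesis using IH Some by (simp add: emitted_def)
  qed (use IH in \<open>simp add: emitted_def\<close>)
qed

lemma walk_in_nodes:
  assumes "leveled_bp n N P" "v \<in> nodes P"
  shows "walk P x v t = Some u \<Longrightarrow> u \<in> nodes P \<and> level P u = level P v + t"
proof (induction t arbitrary: u)
  case (Suc t)
  then obtain w os where w: "walk P x v t = Some w" "consistent_edge P x w = Some (u, os)"
    by (auto simp: bind_eq_Some_conv)
  with Suc.IH[OF w(1)] assms(1) show ?case
    unfolding leveled_bp_def consistent_edge_def by (metis add_Suc_right)
qed (use assms in simp)

lemma walk_le_height:
  assumes "leveled_bp n N P" "v \<in> nodes P" "walk P x v t = Some u"
  shows "t \<le> height P"
proof -
  have "level P u \<le> height P"
    unfolding height_def
  proof (rule Max_ge)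
    show "finite (level P ` nodes P)" using assms(1) by (simp add: leveled_bp_def)
    show "level P u \<in> level P ` nodes P" using walk_in_nodes[OF assms] by blast
  qed
  with walk_in_nodes[OF assms] show ?thesis by linarith
qed

lemma emitted_beyond_height:
  "leveled_bp n N P \<Longrightarrow> v \<in> nodes P \<Longrightarrow> height P < t \<Longrightarrow> emitted P x v t = []"
  using walk_le_height[of n N P v x t] by (cases "walk P x v t") (auto simp: emitted_def)

lemma walk_add: "walk P x v s = Some u \<Longrightarrow> walk P x v (s + j) = walk P x u j"
  by (induction j) simp_all

lemma emitted_add: "walk P x v s = Some u \<Longrightarrow> emitted P x v (s + j) = emitted P x u j"
  by (simp add: emitted_def walk_add)

lemma walk_add_None: "walk P x v s = None \<Longrightarrow> walk P x v (s + j) = None"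
  by (induction j) simp_all

lemma leveled_query_bound:
  "leveled_bp n N P \<Longrightarrow> u \<in> nodes P \<Longrightarrow> query P u = Some i \<Longrightarrow> i < n"
  unfolding leveled_bp_def by (elim conjE, drule (1) bspec[where x = u])+ simp

lemma adaptive_reading_walk:
  assumes "leveled_bp n N P" "v \<in> nodes P"
  shows "adaptive_reading n N (read_at P v)"
proof
  fix x t i assume "read_at P v t x = Some i"
  then obtain u where u: "walk P x v t = Some u" "query P u = Some i"
    by (auto simp: read_at_def bind_eq_Some_conv)
  with walk_in_nodes[OF assms u(1)] show "i < n"
    using leveled_query_bound[OF assms(1)] by blast
next
  fix x y t assume agree: "\<And>s i. s < t \<Longrightarrow> read_at P v s x = Some i \<Longrightarrow> y ! i = x ! i"
  have "walk P y v t = walk P x v t" by (rule walk_cong) (rule agree, auto)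
  then show "read_at P v t y = read_at P v t x" unfolding read_at_def by simp
qed

text \<open>A block from a fixed node is an adaptive reading, and its first \<open>n div 2\<close>
  readings determine its items.\<close>

lemma card_correct_block_le:
  assumes "leveled_bp n (n^2) P" "v \<in> nodes P" "n \<ge> 2 ^ 15" "n \<le> 2 ^ lg"
  shows "real (card {x \<in> inputs n (n^2). distinct x \<and>
      block_items P v (n div 2) x \<subseteq> {(i, rank_in x i) |i. i < n} \<and>
      12 * lg * q \<le> card (block_items P v (n div 2) x)}) \<le> real n ^ 3 * (3/4) ^ q * real (n^2) ^ n"
proof -
  interpret adaptive_reading n "n^2" "read_at P v"
    by (rule adaptive_reading_walk[OF assms(1,2)])
  show ?thesis
  proof (rule card_correct_items_le)
    fix x y assume "y \<in> cyl (n div 2) x"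
    then have agree: "y ! i = x ! i" if "s < n div 2" "read_at P v s x = Some i" for s i
      using that by (auto simp: cyl_def seen_def)
    have "emitted P y v t = emitted P x v t" if "t < n div 2" for t
      by (rule emitted_cong, rule agree) (use that in auto)
    then show "block_items P v (n div 2) y = block_items P v (n div 2) x"
      by (simp add: block_items_def)
  qed (use assms in auto)
qed

section \<open>Total weight of the encodings at one level\<close>

lemma sum_quarter_power_length_le:
  fixes A :: "bool list set"
  assumes "finite A"
  shows "(\<Sum>l\<in>A. (1/4) ^ length l) \<le> (2 :: real)"
proof -
  define M where "M = Max (length ` A)"
  have M: "length ` A \<subseteq> {..M}" using assms by (auto simp: M_def)
  have geo: "(\<Sum>j\<le>M. (1/2 :: real) ^ j) = 2 - (1/2) ^ M" for M
    by (induction M) auto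
  have "(\<Sum>l\<in>A. (1/4 :: real) ^ length l) = (\<Sum>j\<le>M. \<Sum>l\<in>{l \<in> A. length l = j}. (1/4) ^ length l)"
    using M assms by (intro sum.group[symmetric]) auto
  also have "\<dots> = (\<Sum>j\<le>M. card {l \<in> A. length l = j} * (1/4) ^ j)" by simp
  \<comment> \<open>There are \<open>2 ^ j\<close> strings of length \<open>j\<close>; a weight with
    base 4 makes the series geometric with ratio 1/2.\<close>
  also have "\<dots> \<le> (\<Sum>j\<le>M. 2 ^ j * (1/4) ^ j)"
  proof (intro sum_mono mult_right_mono)
    fix j
    have "card {l \<in> A. length l = j} \<le> card {l :: bool list. set l \<subseteq> UNIV \<and> length l = j}"
      by (intro card_mono finite_lists_length_eq) auto
    also have "\<dots> = 2 ^ j" using card_lists_length_eq[of "UNIV :: bool set" j] by simp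
    finally show "real (card {l \<in> A. length l = j}) \<le> 2 ^ j"
      using of_nat_mono[of _ "2 ^ j", where ?'a = real] by simp
  qed simp
  also have "\<dots> = (\<Sum>j\<le>M. (1/2) ^ j)" by (simp add: power_mult_distrib[symmetric])
  also have "\<dots> \<le> 2" by (simp add: geo)
  finally show ?thesis .
qed

text \<open>The pairs lie in the product of their two projections, so the bound 2 for single strings
  is squared.\<close>

lemma sum_quarter_power_node_length_le:
  assumes "finite V" "inj_on (enc P) V"
  shows "(\<Sum>u\<in>V. (1/4) ^ node_length P u) \<le> (4 :: real)"
proof -
  let ?f = "\<lambda>l :: bool list. (1/4 :: real) ^ length l"
  have "(\<Sum>u\<in>V. (1/4) ^ node_length P u) = (\<Sum>p\<in>enc P ` V. ?f (fst p) * ?f (snd p))"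
    using assms(2) by (simp add: sum.reindex node_length_def power_add)
  also have "\<dots> \<le> (\<Sum>p\<in>fst ` enc P ` V \<times> snd ` enc P ` V. ?f (fst p) * ?f (snd p))"
  proof (rule sum_mono2)
    show "enc P ` V \<subseteq> fst ` enc P ` V \<times> snd ` enc P ` V" by (rule subset_fst_snd)
  qed (use assms(1) in auto)
  also have "\<dots> = (\<Sum>l\<in>fst ` enc P ` V. ?f l) * (\<Sum>l\<in>snd ` enc P ` V. ?f l)"
    by (simp add: sum_product sum.cartesian_product split_def)
  also have "\<dots> \<le> 2 * 2"
    using assms(1) by (intro mult_mono sum_quarter_power_length_le sum_nonneg) auto
  finally show ?thesis by simp
qed

text \<open>The threshold for the number of outputs pays, up to the factor needed for the union bound over
  levels, for the number of nodes of a given length.\<close>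

definition rich_at :: "nat \<Rightarrow> nat \<Rightarrow> nat \<Rightarrow> bprog \<Rightarrow> nat \<Rightarrow> nat list \<Rightarrow> bool" where
  "rich_at n lg E P u x \<longleftrightarrow> u \<in> nodes P - blank P \<and>
     block_items P u (n div 2) x \<subseteq> {(i, rank_in x i) |i. i < n} \<and>
     12 * lg * (5 * node_length P u + 3 * E * lg) \<le> card (block_items P u (n div 2) x)"

text \<open>Union bound over the nonblank nodes of the first \<open>n^2\<close> levels:
  \<open>n^2\<close> levels and the factor \<open>n^3\<close> of a block make \<open>n^5\<close>,
  and 4 is the total weight of a level. The height of the program does not enter.\<close>

lemma card_rich_le:
  assumes P: "encoded_bp n (n^2) P" and n: "n \<ge> 2 ^ 15" and lg: "n \<le> 2 ^ lg"
  shows "real (card {x \<in> inputs n (n^2). distinct x \<and> (\<exists>u. level P u < n^2 \<and> rich_at n lg E P u x)})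
    \<le> 4 * real n ^ 5 / real n ^ E * real (n^2) ^ n"
proof -
  define V where "V s = {u \<in> nodes P - blank P. level P u = s}" for s
  define R where "R u = {x \<in> inputs n (n^2). distinct x \<and> rich_at n lg E P u x}" for u
  have lev: "leveled_bp n (n^2) P" and fin: "finite (nodes P)"
    using P by (auto simp: encoded_bp_def leveled_bp_def)
  have fV: "finite (V s)" for s using fin by (simp add: V_def)
  have n0: "n > 0" using n by (rule less_le_trans[rotated]) simp
  have R: "real (card (R u)) \<le> real n ^ 3 * ((1/4) ^ node_length P u / real n ^ E) * real (n^2) ^ n"
    if "u \<in> V s" for u s
  proof -
    let ?q = "5 * node_length P u + 3 * E * lg"
    have "R u \<subseteq> {x \<in> inputs n (n^2). distinct x \<and>
        block_items P u (n div 2) x \<subseteq> {(i, rank_in x i) |i. i < n} \<and>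
        12 * lg * ?q \<le> card (block_items P u (n div 2) x)}" (is "_ \<subseteq> ?S")
      by (auto simp: R_def rich_at_def)
    then have "card (R u) \<le> card ?S" by (rule card_mono[rotated]) simp
    then have "real (card (R u)) \<le> real (card ?S)" by simp
    also have "\<dots> \<le> real n ^ 3 * (3/4) ^ ?q * real (n^2) ^ n"
      using that by (intro card_correct_block_le[OF lev _ n lg]) (simp add: V_def)
    also have "\<dots> \<le> real n ^ 3 * ((1/4) ^ node_length P u / real n ^ E) * real (n^2) ^ n"
    proof (intro mult_right_mono mult_left_mono)
      \<comment> \<open>The 5 and the 3 in \<open>rich_at\<close> come from
        \<open>(3/4) ^ 5 \<le> 1/4\<close> and \<open>(3/4) ^ 3 \<le> 1/2\<close>.\<close>
      have "(3/4 :: real) ^ ?q = ((3/4) ^ 5) ^ node_length P u * (((3/4) ^ 3) ^ lg) ^ E"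
        unfolding power_add power_mult[symmetric] by (simp add: mult_ac)
      also have "\<dots> \<le> (1/4) ^ node_length P u * ((1/2) ^ lg) ^ E"
        by (intro mult_mono power_mono) (auto simp: eval_nat_numeral)
      also have "\<dots> \<le> (1/4) ^ node_length P u * (1 / n) ^ E"
      proof (intro mult_left_mono power_mono)
        have "real n \<le> 2 ^ lg" using of_nat_mono[OF lg, where ?'a = real] by simp
        then show "(1/2) ^ lg \<le> 1 / real n"
          using n0 by (simp add: power_one_over field_simps)
      qed auto
      finally show "(3/4 :: real) ^ ?q \<le> (1/4) ^ node_length P u / real n ^ E"
        by (simp add: power_one_over)
    qed auto
    finally show ?thesis .
  qed
  have "{x \<in> inputs n (n^2). distinct x \<and> (\<exists>u. level P u < n^2 \<and> rich_at n lg E P u x)}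
      \<subseteq> (\<Union>s<n^2. \<Union>u\<in>V s. R u)" (is "?L \<subseteq> _")
    by (auto simp: R_def V_def rich_at_def)
  then have "card ?L \<le> card (\<Union>s<n^2. \<Union>u\<in>V s. R u)"
    by (rule card_mono[rotated]) (use fV in \<open>auto simp: R_def\<close>)
  also have "\<dots> \<le> (\<Sum>s<n^2. card (\<Union>u\<in>V s. R u))" by (rule card_UN_le) simp
  also have "\<dots> \<le> (\<Sum>s<n^2. \<Sum>u\<in>V s. card (R u))" by (intro sum_mono card_UN_le fV)
  finally have "real (card ?L) \<le> real (\<Sum>s<n^2. \<Sum>u\<in>V s. card (R u))" by (simp only: of_nat_le_iff)
  also have "\<dots> = (\<Sum>s<n^2. \<Sum>u\<in>V s. real (card (R u)))" by simp
  also have "\<dots> \<le> (\<Sum>s<n^2. \<Sum>u\<in>V s. real n ^ 3 * ((1/4) ^ node_length P u / real n ^ E) * real (n^2) ^ n)"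
    by (intro sum_mono) (rule R)
  also have "\<dots> = (\<Sum>s<n^2. real n ^ 3 / real n ^ E * real (n^2) ^ n * (\<Sum>u\<in>V s. (1/4) ^ node_length P u))"
    by (simp add: sum_distrib_left sum_divide_distrib mult_ac)
  also have "\<dots> \<le> (\<Sum>s<n^2. real n ^ 3 / real n ^ E * real (n^2) ^ n * 4)"
  proof (intro sum_mono mult_left_mono sum_quarter_power_node_length_le fV)
    show "inj_on (enc P) (V s)" for s
      using P by (auto simp: inj_on_def V_def encoded_bp_def)
  qed auto
  also have "\<dots> = 4 * real n ^ 5 / real n ^ E * real (n^2) ^ n"
    by (simp add: eval_nat_numeral)
  finally show ?thesis .
qed

section \<open>The lower bound\<close>

text \<open>"At most" holds for \<open>A\<close> and for its complement below \<open>m\<close>,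
  while the total is exact by distinctness; hence equality. This turns the item set of a block into
  a sum over levels.\<close>

lemma card_UN_set_eq_sum_length:
  assumes dist: "distinct (concat (map f [0..<m]))" and A: "finite A" and nil: "\<And>t. m \<le> t \<Longrightarrow> f t = []"
  shows "card (\<Union>t\<in>A. set (f t)) = (\<Sum>t\<in>A. length (f t))"
proof -
  let ?S = "\<lambda>A. \<Union>t\<in>A. set (f t)" and ?l = "\<lambda>A. \<Sum>t\<in>A. length (f t)"
  have le: "card (?S B) \<le> ?l B" if "finite B" for B
  proof -
    have "card (?S B) \<le> (\<Sum>t\<in>B. card (set (f t)))" by (rule card_UN_le[OF that])
    also have "\<dots> \<le> ?l B" by (intro sum_mono card_length)
    finally show ?thesis .
  qed
  define B where "B = {..<m} - A"
  have "?l {..<m} = length (concat (map f [0..<m]))"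
    by (simp add: length_concat sum_list_sum_nth comp_def atLeast0LessThan)
  also have "\<dots> = card (set (concat (map f [0..<m])))"
    using distinct_card[OF dist] by simp
  also have "set (concat (map f [0..<m])) = ?S {..<m}" by auto
  also have "?S {..<m} \<subseteq> ?S A \<union> ?S B" by (auto simp: B_def)
  then have "card (?S {..<m}) \<le> card (?S A \<union> ?S B)"
    by (rule card_mono[rotated]) (use A in \<open>auto simp: B_def\<close>)
  also have "\<dots> \<le> card (?S A) + card (?S B)" by (rule card_Un_le)
  also have "card (?S B) \<le> ?l B" by (rule le) (simp add: B_def)
  finally have "?l {..<m} \<le> card (?S A) + ?l B" by simp
  moreover have "?l {..<m} = ?l A + ?l B"
  proof -
    have "?l ({..<m} \<union> A) = ?l A + ?l B"
      unfolding B_def using A by (subst sum.union_disjoint[symmetric]) (auto intro!: sum.cong)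
    moreover have "?l ({..<m} \<union> A) = ?l {..<m}"
      using A nil by (intro sum.mono_neutral_right) auto
    ultimately show ?thesis by simp
  qed
  ultimately show ?thesis using le[OF A] by simp
qed

text \<open>Every value at a time \<open>t \<ge> h\<close> is counted in \<open>h\<close> windows; the window at time 0 takes care of
  the earlier ones.\<close>

lemma sum_le_if_windows_le:
  fixes e l :: "nat \<Rightarrow> nat"
  assumes total: "(\<Sum>t\<le>T. e t) = n" and l0: "l 0 = 0"
    and win: "\<And>s. s \<le> T \<Longrightarrow> (\<Sum>j<h. e (s + j)) \<le> a * (b * l s + d)"
  shows "h * n \<le> a * b * (\<Sum>s\<le>T. l s) + a * d * (T + 1) + h * (a * d)"
proof -
  have "{..T} \<subseteq> {..<h} \<union> {h..T}" by auto
  then have "(\<Sum>t\<le>T. e t) \<le> (\<Sum>t\<in>{..<h} \<union> {h..T}. e t)" by (rule sum_mono2[rotated]) auto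
  also have "\<dots> = (\<Sum>t<h. e t) + (\<Sum>t\<in>{h..T}. e t)" by (rule sum.union_disjoint) auto
  finally have "n \<le> a * d + (\<Sum>t\<in>{h..T}. e t)" using win[of 0] l0 total by simp
  then have "h * n \<le> h * (a * d) + h * (\<Sum>t\<in>{h..T}. e t)"
    by (metis distrib_left mult_le_mono2)
  also have "h * (\<Sum>t\<in>{h..T}. e t) = (\<Sum>j<h. \<Sum>t\<in>{h..T}. e t)" by simp
  also have "\<dots> \<le> (\<Sum>j<h. \<Sum>s\<le>T. e (s + j))"
  proof (rule sum_mono)
    fix j assume j: "j \<in> {..<h}"
    have "{h..T} \<subseteq> (\<lambda>s. s + j) ` {..T}"
    proof
      fix t assume "t \<in> {h..T}"
      with j show "t \<in> (\<lambda>s. s + j) ` {..T}" by (intro image_eqI[of _ _ "t - j"]) auto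
    qed
    then have "(\<Sum>t\<in>{h..T}. e t) \<le> (\<Sum>t\<in>(\<lambda>s. s + j) ` {..T}. e t)" by (rule sum_mono2[rotated]) auto
    also have "\<dots> = (\<Sum>s\<le>T. e (s + j))" by (simp add: sum.reindex)
    finally show "(\<Sum>t\<in>{h..T}. e t) \<le> (\<Sum>s\<le>T. e (s + j))" .
  qed
  also have "\<dots> = (\<Sum>s\<le>T. \<Sum>j<h. e (s + j))" by (rule sum.swap)
  also have "\<dots> \<le> (\<Sum>s\<le>T. a * (b * l s + d))" by (rule sum_mono) (use win in simp)
  also have "\<dots> = a * b * (\<Sum>s\<le>T. l s) + a * d * (T + 1)"
    by (simp add: sum.distrib sum_distrib_left algebra_simps)
  finally show ?thesis by simp
qed

text \<open>If no such node is rich, every window of \<open>n div 2\<close> levels emits few items,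
  and summing the windows contradicts \<open>small\<close>. There 60 is \<open>12 * 5\<close> and 36
  is \<open>12 * 3\<close>, from the threshold in \<open>rich_at\<close>.\<close>

lemma ranks_correctly_imp_rich:
  assumes P: "encoded_bp n (n^2) P" and x: "x \<in> inputs n (n^2)" and cor: "ranks_correctly P x"
    and pos: "lg > 0" "E > 0"
    and small: "60 * lg * cum_mem P x + 36 * E * lg^2 * (last_output P x + 1) + (n div 2) * (36 * E * lg^2)
      < (n div 2) * n"
  shows "\<exists>u. level P u \<le> last_output P x \<and> rich_at n lg E P u x"
proof (rule ccontr)
  assume none: "\<not> ?thesis"
  define e where "e t = length (emitted_at P x t)" for t
  define l where "l s = (case visited P x s of None \<Rightarrow> 0 | Some v \<Rightarrow> node_length P v)" for s
  define T where "T = last_output P x"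
  let ?h = "n div 2" and ?H = "height P"
  have lev: "leveled_bp n (n^2) P" using P by (simp add: encoded_bp_def)
  have start: "start P \<in> nodes P" "level P (start P) = 0" using lev by (auto simp: leveled_bp_def)
  have beyond: "emitted_at P x t = []" if "?H < t" for t
    using emitted_beyond_height[OF lev start(1) that] .
  have out: "distinct (concat (map (emitted_at P x) [0..<Suc ?H]))"
    "set (concat (map (emitted_at P x) [0..<Suc ?H])) = {(i, rank_in x i) |i. i < n}"
    using cor x by (auto simp: ranks_correctly_def produces_def outputs_from_def inputs_def simp del: upt_Suc)
  have T: "T \<le> ?H" "\<And>t. T < t \<Longrightarrow> emitted_at P x t = []"
  proof -
    let ?M = "insert 0 {t. t \<le> ?H \<and> emitted_at P x t \<noteq> []}"
    have fin: "finite ?M" by simp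
    have "T \<in> ?M" unfolding T_def last_output_def by (rule Max_in[OF fin]) simp
    then show "T \<le> ?H" by auto
    fix t assume t: "T < t"
    show "emitted_at P x t = []"
    proof (rule ccontr)
      assume ne: "emitted_at P x t \<noteq> []"
      then have "t \<le> ?H" using beyond[of t] by (meson not_le)
      with ne have "t \<le> T" unfolding T_def last_output_def by (intro Max_ge[OF fin]) simp
      with t show False by simp
    qed
  qed
  have total: "(\<Sum>t\<le>T. e t) = n"
  proof -
    have "(\<Sum>t\<le>T. e t) = (\<Sum>t\<in>{..T}. length (emitted_at P x t))" by (simp add: e_def)
    also have "\<dots> = card (\<Union>t\<in>{..T}. set (emitted_at P x t))"
      by (rule card_UN_set_eq_sum_length[OF out(1), symmetric]) (use beyond in auto)
    also have "(\<Union>t\<in>{..T}. set (emitted_at P x t)) = {(i, rank_in x i) |i. i < n}"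
    proof -
      have "(\<Union>t\<in>{..T}. set (emitted_at P x t)) = (\<Union>t\<in>{..<Suc ?H}. set (emitted_at P x t))"
      proof (intro equalityI subsetI)
        fix z assume "z \<in> (\<Union>t\<in>{..<Suc ?H}. set (emitted_at P x t))"
        then obtain t where "z \<in> set (emitted_at P x t)" by auto
        moreover from this have "t \<le> T" using T(2)[of t] by (cases "t \<le> T") auto
        ultimately show "z \<in> (\<Union>t\<in>{..T}. set (emitted_at P x t))" by auto
      qed (use T(1) in force)
      also have "\<dots> = set (concat (map (emitted_at P x) [0..<Suc ?H]))"
        by (simp only: set_concat set_map set_upt image_image atLeast0LessThan)
      finally show ?thesis using out(2) by simp
    qed
    also have "{(i, rank_in x i) |i. i < n} = (\<lambda>i. (i, rank_in x i)) ` {..<n}" by auto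
    also have "card \<dots> = n" by (subst card_image) (auto simp: inj_on_def)
    finally show ?thesis .
  qed
  \<comment> \<open>The root has the empty encoding, so the window at level 0 is bounded by the
    additive term alone.\<close>
  have l0: "l 0 = 0" using P by (simp add: l_def node_length_def encoded_bp_def)
  have "(\<Sum>j<?h. e (s + j)) \<le> 12 * lg * (5 * l s + 3 * E * lg)" if s: "s \<le> T" for s
  proof (cases "visited P x s")
    case None
    then have "e (s + j) = 0" for j by (simp add: e_def emitted_def walk_add_None)
    then show ?thesis by simp
  next
    case (Some u)
    note u = walk_in_nodes[OF lev start(1) Some]
    have em: "emitted P x u j = emitted_at P x (s + j)" for j using emitted_add[OF Some] by simp
    have sub: "block_items P u ?h x \<subseteq> {(i, rank_in x i) |i. i < n}"
    proof
      fix z assume "z \<in> block_items P u ?h x"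
      then obtain j where j: "z \<in> set (emitted_at P x (s + j))" by (auto simp: block_items_def em)
      then have "s + j \<in> {..<Suc ?H}" using beyond[of "s + j"] by (cases "s + j \<le> ?H") auto
      with j have "z \<in> set (concat (map (emitted_at P x) [0..<Suc ?H]))"
        by (auto simp del: upt_Suc)
      then show "z \<in> {(i, rank_in x i) |i. i < n}" unfolding out(2) .
    qed
    have "block_items P u ?h x = (\<Union>t\<in>(\<lambda>j. s + j) ` {..<?h}. set (emitted_at P x t))"
      by (simp add: block_items_def em)
    also have "card \<dots> = (\<Sum>t\<in>(\<lambda>j. s + j) ` {..<?h}. length (emitted_at P x t))"
      by (rule card_UN_set_eq_sum_length[OF out(1)]) (use beyond in auto)
    also have "\<dots> = (\<Sum>j<?h. e (s + j))" by (simp add: sum.reindex e_def)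
    finally have crd: "card (block_items P u ?h x) = (\<Sum>j<?h. e (s + j))" .
    show ?thesis
    proof (rule ccontr)
      assume "\<not> ?thesis"
      then have big: "12 * lg * (5 * node_length P u + 3 * E * lg) < card (block_items P u ?h x)"
        using Some by (simp add: crd l_def)
      \<comment> \<open>A node whose block emits anything is not blank, since blank nodes have no
        outputs on any input.\<close>
      then have "block_items P u ?h x \<noteq> {}" by auto
      then obtain j where "emitted P x u j \<noteq> []" by (auto simp: block_items_def)
      moreover from this have "j \<le> ?H"
        using emitted_beyond_height[OF lev conjunct1[OF u], of j x] by (meson not_le)
      ultimately have "outputs_from P x u \<noteq> []"
        unfolding outputs_from_def by (auto simp del: upt_Suc)
      then have "u \<notin> blank P" using P x by (auto simp: encoded_bp_def)
      with u sub big have "rich_at n lg E P u x" by (simp add: rich_at_def)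
      moreover have "level P u \<le> T" using u start(2) s by simp
      ultimately show False using none T_def by blast
    qed
  qed
  from sum_le_if_windows_le[OF total l0 this]
  have "?h * n \<le> 12 * lg * 5 * (\<Sum>s\<le>T. l s) + 12 * lg * (3 * E * lg) * (T + 1) + ?h * (12 * lg * (3 * E * lg))" .
  moreover have "12 * lg * (3 * E * lg) = 36 * E * lg^2" by (simp add: power2_eq_square)
  ultimately have "?h * n \<le> 12 * lg * 5 * (\<Sum>s\<le>T. l s) + 36 * E * lg^2 * (T + 1) + ?h * (36 * E * lg^2)"
    by (simp only:)
  moreover have "(\<Sum>s\<le>T. l s) \<le> cum_mem P x"
    unfolding cum_mem_def l_def using T(1) by (intro sum_mono2) auto
  then have "12 * lg * 5 * (\<Sum>s\<le>T. l s) \<le> 12 * lg * 5 * cum_mem P x" by (rule mult_le_mono2)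
  moreover have "12 * lg * 5 = 60 * lg" by simp
  ultimately show False using small unfolding T_def by linarith
qed

section \<open>From independent contents to distinct ones\<close>

lemma card_distinct_inputs_ge:
  assumes "n \<ge> 2"
  shows "real (n^2) ^ n \<le> 9 * card {x \<in> inputs n (n^2). distinct x}"
proof -
  have nn: "n \<le> n^2" by (simp add: power2_eq_square)
  have "{x \<in> inputs n (n^2). distinct x} = {xs. length xs = n \<and> distinct xs \<and> set xs \<subseteq> {1..n^2}}"
    by (auto simp: inputs_def)
  then have "card {x \<in> inputs n (n^2). distinct x} = \<Prod>{n^2 - n + 1..n^2}"
    using card_lists_distinct_length_eq[of "{1..n^2}" n] nn by simp
  moreover have "(n^2 - n) ^ n \<le> \<Prod>{n^2 - n + 1..n^2}"
  proof -
    have "(n^2 - n) ^ n = (\<Prod>k\<in>{n^2 - n + 1..n^2}. n^2 - n)" using nn by simp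
    also have "\<dots> \<le> \<Prod>{n^2 - n + 1..n^2}" by (rule prod_mono) auto
    finally show ?thesis .
  qed
  ultimately have "(n^2 - n) ^ n \<le> card {x \<in> inputs n (n^2). distinct x}" by simp
  then have "real ((n^2 - n) ^ n) \<le> card {x \<in> inputs n (n^2). distinct x}" by (simp only: of_nat_le_iff)
  \<comment> \<open>The ratio is the \<open>n\<close>-th power of \<open>n / (n - 1)\<close>, at
    most \<open>exp (n / (n - 1)) \<le> exp 2 \<le> 9\<close> because
    \<open>n \<ge> 2\<close>.\<close>
  moreover have "real (n^2) ^ n \<le> 9 * real ((n^2 - n) ^ n)"
  proof -
    define d where "d = real n - 1"
    have d: "d \<ge> 1" "real n = d + 1" using assms by (auto simp: d_def)
    have eq: "real (n^2 - n) = real n * d" using nn by (simp add: d_def of_nat_diff power2_eq_square algebra_simps)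
    have "real n / d \<le> exp (1 / d)"
      using exp_ge_add_one_self[of "1 / d"] d by (simp add: field_simps)
    then have "(real n / d) ^ n \<le> exp (1 / d) ^ n" using d by (intro power_mono) auto
    also have "\<dots> = exp (real n * (1 / d))" by (rule exp_of_nat_mult[symmetric])
    also have "\<dots> \<le> exp 2" using d by (simp add: field_simps)
    also have "(exp 2 :: real) = exp 1 * exp 1" by (simp add: exp_add[symmetric])
    also have "\<dots> \<le> 3 * 3" using exp_le by (intro mult_mono) auto
    finally have "real n ^ n \<le> 9 * d ^ n" using d by (simp add: power_divide field_simps)
    then have "real n ^ n * real n ^ n \<le> real n ^ n * (9 * d ^ n)" by (intro mult_left_mono) auto
    moreover have "real (n^2) ^ n = real n ^ n * real n ^ n"
      by (simp add: power2_eq_square power_mult_distrib)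
    moreover have "9 * real ((n^2 - n) ^ n) = real n ^ n * (9 * d ^ n)"
      by (simp only: of_nat_power eq power_mult_distrib mult_ac)
    ultimately show ?thesis by simp
  qed
  ultimately show ?thesis by linarith
qed

lemma prob_mu:
  assumes "n \<ge> 2"
  shows "measure_pmf.prob (\<mu> n) S \<le> 9 * card {x \<in> inputs n (n^2). distinct x \<and> x \<in> S} / real (n^2) ^ n"
proof -
  let ?D = "{x \<in> inputs n (n^2). distinct x}"
  have pos: "real (n^2) ^ n > 0" using assms by simp
  then have cD: "real (card ?D) > 0" using card_distinct_inputs_ge[OF assms] by linarith
  then have "?D \<noteq> {}" by (metis card.empty of_nat_0 less_irrefl)
  then have "measure_pmf.prob (\<mu> n) S = card (?D \<inter> S) / card ?D"
    unfolding \<mu>_def by (intro measure_pmf_of_set) auto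
  also have "?D \<inter> S = {x \<in> inputs n (n^2). distinct x \<and> x \<in> S}" by auto
  also have "card {x \<in> inputs n (n^2). distinct x \<and> x \<in> S} / card ?D \<le>
      card {x \<in> inputs n (n^2). distinct x \<and> x \<in> S} / (real (n^2) ^ n / 9)"
    using card_distinct_inputs_ge[OF assms] pos by (intro divide_left_mono) auto
  finally show ?thesis by (simp add: mult.commute)
qed

text \<open>Correct and cheap at once is rare for any encoded program, however often it errs. The
  constants depend only on \<open>c\<close>, so all the probability statements follow by
  subtraction.\<close>

lemma prob_correct_not_costly:
  assumes "c \<ge> 0"
  shows "\<exists>\<epsilon>>0. \<exists>n0. \<forall>n\<ge>n0. \<forall>P. encoded_bp n (n^2) P \<longrightarrow>
    measure_pmf.prob (\<mu> n) {x. ranks_correctly P x \<and> \<not> costly \<epsilon> n P x} < 1/32 * real n powr (- c)"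
proof -
  \<comment> \<open>Chosen for \<open>5 - E \<le> - 1 - c\<close>, where 5 is the power of
    \<open>n\<close> in \<open>card_rich_le\<close>. The spare \<open>1/n\<close> absorbs the
    constant \<open>36 = 9 * 4\<close> once \<open>n > 1152 = 36 * 32\<close>.\<close>
  define E where "E = nat \<lceil>c\<rceil> + 6"
  define K where "K = real E"
  \<comment> \<open>Since \<open>lg\<close> is at most twice the logarithm, 60 and 36 grow to 120
    and 144, and the main terms total \<open>n^2 / 16\<close>. Lower order terms stay below
    \<open>n^2 / 8\<close>, and the sum is less than
    \<open>n^2 / 4 \<le> (n div 2) * n\<close>.\<close>
  define \<epsilon> where "\<epsilon> = 1 / (16 * (120 + 144 * K))"
  have K: "K > 0" by (simp add: K_def E_def)
  have eps: "\<epsilon> > 0" "\<epsilon> \<le> 1" using K by (auto simp: \<epsilon>_def field_simps)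
  have "eventually (\<lambda>n::nat. 144 * K * log 2 n ^ 2 + 72 * K * (n * log 2 n ^ 2) < real n ^ 2 / 8) sequentially"
    using K by real_asymp
  then obtain n1 where n1: "\<And>n. n \<ge> n1 \<Longrightarrow>
      144 * K * log 2 (real n) ^ 2 + 72 * K * (real n * log 2 (real n) ^ 2) < real n ^ 2 / 8"
    by (auto simp: eventually_sequentially)
  have "measure_pmf.prob (\<mu> n) {x. ranks_correctly P x \<and> \<not> costly \<epsilon> n P x} < 1/32 * real n powr (- c)"
    if n: "n \<ge> max n1 (2 ^ 15)" and P: "encoded_bp n (n^2) P" for n P
  proof -
    have n15: "2 ^ 15 \<le> n" and n2: "n \<ge> 2" and nbig: "real n > 1152" using n by auto
    define y where "y = log 2 (real n)"
    define lg where "lg = nat \<lceil>y\<rceil>"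
    have "log 2 2 \<le> y" unfolding y_def using n2 by (subst log_le_cancel_iff) auto
    then have y1: "y \<ge> 1" by simp
    have lgy: "y \<le> real lg" "real lg \<le> 2 * y" "lg > 0" using y1 unfolding lg_def by linarith+
    have lg: "n \<le> 2 ^ lg"
    proof -
      have "real n = 2 powr y" using n2 by (simp add: y_def)
      also have "\<dots> \<le> 2 powr real lg" using lgy by (intro powr_mono) auto
      also have "\<dots> = real (2 ^ lg)" by (simp add: powr_realpow)
      finally show ?thesis by (simp only: of_nat_le_iff)
    qed
    have rich: "\<exists>u. level P u < n^2 \<and> rich_at n lg E P u x"
      if x: "x \<in> inputs n (n^2)" "ranks_correctly P x" "\<not> costly \<epsilon> n P x" for x
    proof -
      let ?T = "real (last_output P x)" and ?M = "real (cum_mem P x)"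
      have T: "?T < \<epsilon> * (real n ^ 2 / y ^ 2)" and M: "?M < \<epsilon> * (real n ^ 2 / y)"
        using x(3) by (auto simp: costly_def y_def)
      have lg2: "real lg ^ 2 \<le> 4 * y ^ 2"
        using power_mono[OF lgy(2), of 2] by (simp add: power_mult_distrib)
      have a: "60 * real lg * ?M \<le> 120 * \<epsilon> * real n ^ 2"
      proof -
        have "60 * real lg * ?M \<le> 60 * (2 * y) * (\<epsilon> * (real n ^ 2 / y))"
          using lgy M y1 by (intro mult_mono) auto
        then show ?thesis using y1 by simp
      qed
      have b: "36 * K * real lg ^ 2 * (?T + 1) \<le> 144 * K * \<epsilon> * real n ^ 2 + 144 * K * y ^ 2"
      proof -
        have "36 * K * real lg ^ 2 * (?T + 1) \<le> 36 * K * (4 * y ^ 2) * (\<epsilon> * (real n ^ 2 / y ^ 2) + 1)"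
          using lg2 T K by (intro mult_mono) auto
        also have "\<dots> = 144 * K * \<epsilon> * real n ^ 2 + 144 * K * y ^ 2" using y1 by (simp add: field_simps)
        finally show ?thesis .
      qed
      have h: "real (n div 2) \<le> real n / 2" "real n / 4 \<le> real (n div 2)" using n2 by linarith+
      have d: "real (n div 2) * (36 * K * real lg ^ 2) \<le> 72 * K * (real n * y ^ 2)"
      proof -
        have "real (n div 2) * (36 * K * real lg ^ 2) \<le> real n / 2 * (36 * K * (4 * y ^ 2))"
          using h lg2 K by (intro mult_mono) auto
        then show ?thesis by simp
      qed
      have "(120 + 144 * K) * \<epsilon> = 1 / 16" using K by (simp add: \<epsilon>_def field_simps)
      then have "120 * \<epsilon> * real n ^ 2 + 144 * K * \<epsilon> * real n ^ 2 = real n ^ 2 / 16"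
        by (metis (no_types, opaque_lifting) distrib_right mult.assoc mult.left_neutral times_divide_eq_left)
      moreover have "144 * K * y ^ 2 + 72 * K * (real n * y ^ 2) < real n ^ 2 / 8"
        using n1[of n] n by (simp add: y_def)
      moreover have "real n ^ 2 / 4 \<le> real (n div 2) * real n"
        using mult_right_mono[OF h(2), of "real n"] by (simp add: power2_eq_square)
      moreover have "real n ^ 2 > 0" using n2 by simp
      ultimately have "60 * real lg * ?M + 36 * K * real lg ^ 2 * (?T + 1) + real (n div 2) * (36 * K * real lg ^ 2)
          < real (n div 2) * real n"
        using a b d by linarith
      then have "real (60 * lg * cum_mem P x + 36 * E * lg^2 * (last_output P x + 1) + (n div 2) * (36 * E * lg^2))
          < real ((n div 2) * n)"
        by (simp only: of_nat_add of_nat_mult of_nat_power K_def of_nat_numeral of_nat_1)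
      then have "60 * lg * cum_mem P x + 36 * E * lg^2 * (last_output P x + 1) + (n div 2) * (36 * E * lg^2)
          < (n div 2) * n"
        by (simp only: of_nat_less_iff)
      from ranks_correctly_imp_rich[OF P x(1,2) lgy(3) _ this]
      obtain u where u: "level P u \<le> last_output P x" "rich_at n lg E P u x" by (auto simp: E_def)
      \<comment> \<open>A run that is not costly has its last output below level \<open>n^2\<close>,
        the range of the union bound.\<close>
      have "\<epsilon> * (real n ^ 2 / y ^ 2) \<le> 1 * (real n ^ 2 / 1)"
        using eps y1 by (intro mult_mono divide_left_mono) auto
      then have "?T < real n ^ 2" using T by linarith
      then have "?T < real (n^2)" by (simp only: of_nat_power)
      then have "last_output P x < n^2" by (simp only: of_nat_less_iff)
      with u show ?thesis by (auto intro: le_less_trans)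
    qed
    let ?B = "{x \<in> inputs n (n^2). distinct x \<and> x \<in> {x. ranks_correctly P x \<and> \<not> costly \<epsilon> n P x}}"
    have N0: "real (n^2) ^ n > 0" using n2 by simp
    have "?B \<subseteq> {x \<in> inputs n (n^2). distinct x \<and> (\<exists>u. level P u < n^2 \<and> rich_at n lg E P u x)}"
      using rich by blast
    then have "card ?B \<le> card {x \<in> inputs n (n^2). distinct x \<and> (\<exists>u. level P u < n^2 \<and> rich_at n lg E P u x)}"
      by (rule card_mono[rotated]) simp
    then have "real (card ?B) \<le> 4 * real n ^ 5 / real n ^ E * real (n^2) ^ n"
      using card_rich_le[OF P n15 lg, of E] by linarith
    then have "9 * card ?B / real (n^2) ^ n \<le> 36 * real n ^ 5 / real n ^ E"
      using N0 by (simp add: divide_le_eq)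
    with prob_mu[OF n2, of "{x. ranks_correctly P x \<and> \<not> costly \<epsilon> n P x}"]
    have "measure_pmf.prob (\<mu> n) {x. ranks_correctly P x \<and> \<not> costly \<epsilon> n P x} \<le> 36 * real n ^ 5 / real n ^ E"
      by linarith
    also have "\<dots> = 36 * real n powr (5 - real E)"
    proof -
      have "real n ^ 5 = real n powr 5" "real n ^ E = real n powr real E"
        using n2 by (simp_all add: powr_realpow)
      then show ?thesis by (simp only: powr_diff times_divide_eq_right)
    qed
    also have "\<dots> \<le> 36 * real n powr (- 1 - c)"
    proof -
      have "5 - real E \<le> - 1 - c" using assms by (simp add: E_def)
      then show ?thesis using n2 by (intro mult_left_mono powr_mono) auto
    qed
    also have "\<dots> = 36 / real n * real n powr (- c)"
      using n2 by (simp add: powr_diff powr_minus field_simps)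
    also have "\<dots> < 1/32 * real n powr (- c)"
      using nbig n2 by (intro mult_strict_right_mono) (auto simp: field_simps)
    finally show ?thesis .
  qed
  then show ?thesis using eps(1) by blast
qed

section \<open>From sorting to ranking\<close>

text \<open>The tag breaks ties by position, exactly as \<open>rank_in\<close> does.\<close>

lemma pairing_le_iff:
  assumes "a \<ge> 1" "b \<ge> 1" "i < n" "j < n"
  shows "pairing n a (Suc j) \<le> pairing n b (Suc i) \<longleftrightarrow> a < b \<or> a = b \<and> j \<le> i"
proof -
  have less: "pairing n a (Suc j) < pairing n b (Suc i)" if "1 \<le> a" "a < b" "j < n" for a b i j
  proof -
    have "(a - 1) * n + n = a * n" using that by (simp add: diff_mult_distrib)
    also have "\<dots> \<le> (b - 1) * n" using that by (intro mult_le_mono1) simp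
    finally show ?thesis using that by (simp add: pairing_def)
  qed
  show ?thesis
    using less[of a b j i] less[of b a i j] assms by (cases a b rule: linorder_cases) (auto simp: pairing_def)
qed

lemma length_tagged [simp]: "length (tagged y) = length y"
  by (simp add: tagged_def)

lemma nth_tagged: "i < length y \<Longrightarrow> tagged y ! i = pairing (length y) (y ! i) (Suc i)"
  by (simp add: tagged_def)

lemma tagged_in_inputs:
  assumes "y \<in> inputs n (n^2)"
  shows "tagged y \<in> inputs n (n * n^2)"
  unfolding inputs_iff
proof (intro conjI allI impI)
  show len: "length (tagged y) = n" using assms by (simp add: inputs_iff)
  fix i assume i: "i < n"
  then have y: "y ! i \<in> {1..n^2}" using assms by (simp add: inputs_iff)
  then have "(y ! i - 1) * n + n = y ! i * n" by (simp add: diff_mult_distrib)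
  also have "\<dots> \<le> n * n^2" using y by (simp add: mult.commute)
  finally show "tagged y ! i \<in> {1..n * n^2}"
    using i len by (simp add: nth_tagged pairing_def)
qed

lemma tag_mod: "i < n \<Longrightarrow> (pairing n a (Suc i) - Suc 0) mod n = i"
  by (simp add: pairing_def)

text \<open>Tagged contents are distinct and ordered as in \<open>rank_in\<close>, so the rank
  counts the sorted entries up to position \<open>p\<close>; positions start at 0, hence
  \<open>p + 1\<close>.\<close>

lemma rank_in_sort_tagged:
  assumes y: "y \<in> inputs n (n^2)" and i: "i < n" and p: "p < n"
    and eq: "sort (tagged y) ! p = tagged y ! i"
  shows "rank_in y i = p + 1"
proof -
  let ?z = "tagged y" and ?s = "sort (tagged y)"
  have len: "length y = n" "\<And>j. j < n \<Longrightarrow> y ! j \<ge> 1" using y by (auto simp: inputs_iff)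
  have le: "?z ! j \<le> ?z ! k \<longleftrightarrow> y ! j < y ! k \<or> y ! j = y ! k \<and> j \<le> k" if "j < n" "k < n" for j k
    using that len by (simp add: nth_tagged pairing_le_iff)
  have inj: "inj_on ((!) ?z) {..<n}"
  proof (rule inj_onI)
    fix j k assume jk: "j \<in> {..<n}" "k \<in> {..<n}" "?z ! j = ?z ! k"
    then show "j = k" using le[of j k] le[of k j] by auto
  qed
  have "distinct ?z"
    unfolding distinct_conv_nth
  proof (intro allI impI notI)
    fix j k assume "j < length ?z" "k < length ?z" "j \<noteq> k" "?z ! j = ?z ! k"
    then show False using inj_onD[OF inj, of j k] len by simp
  qed
  then have dist: "distinct ?s" by simp
  have "rank_in y i = card {j \<in> {..<n}. ?z ! j \<le> ?z ! i}"
    unfolding rank_in_def using le[OF _ i] len by (intro arg_cong[where f = card]) auto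
  also have "\<dots> = card ((!) ?z ` {j \<in> {..<n}. ?z ! j \<le> ?z ! i})"
    by (rule card_image[symmetric], rule inj_on_subset[OF inj]) auto
  also have "(!) ?z ` {j \<in> {..<n}. ?z ! j \<le> ?z ! i} = {v \<in> set ?z. v \<le> ?s ! p}"
    using len by (auto simp: eq set_conv_nth)
  also have "set ?z = set ?s" by simp
  also have "{v \<in> set ?s. v \<le> ?s ! p} = (!) ?s ` {..p}"
  proof (intro equalityI subsetI)
    fix v assume "v \<in> {v \<in> set ?s. v \<le> ?s ! p}"
    then have v: "v \<in> set ?s" "v \<le> ?s ! p" by blast+
    from v(1) obtain q where q: "q < length ?s" "?s ! q = v" unfolding in_set_conv_nth by blast
    have "q \<le> p"
    proof (rule ccontr)
      assume "\<not> q \<le> p"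
      then have "?s ! p \<le> ?s ! q" using q(1) by (intro sorted_nth_mono) auto
      then have "?s ! p = ?s ! q" using q(2) v(2) by simp
      then show False using \<open>\<not> q \<le> p\<close> q(1) p len nth_eq_iff_index_eq[OF dist, of p q] by simp
    qed
    then show "v \<in> (!) ?s ` {..p}" using q(2) by auto
  next
    fix v assume "v \<in> (!) ?s ` {..p}"
    then obtain q where "v = ?s ! q" "q \<le> p" by auto
    then show "v \<in> {v \<in> set ?s. v \<le> ?s ! p}"
      using p len sorted_nth_mono[of ?s q p] nth_mem[of q ?s] by (simp del: set_sort)
  qed
  also have "card \<dots> = card {..p}"
    by (rule card_image, rule inj_on_nth[OF dist]) (use p len in auto)
  finally show ?thesis by simp
qed

lemma rank_of_sort_simps [simp]:
  "nodes (rank_of_sort n P) = nodes P" "level (rank_of_sort n P) = level P"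
  "start (rank_of_sort n P) = start P" "query (rank_of_sort n P) = query P"
  "enc (rank_of_sort n P) = enc P" "blank (rank_of_sort n P) = blank P"
  "height (rank_of_sort n P) = height P"
  by (simp_all add: rank_of_sort_def height_def)

lemma node_length_rank_of_sort [simp]: "node_length (rank_of_sort n P) = node_length P"
  by (simp add: node_length_def fun_eq_iff)

abbreviation item_of_sort :: "nat \<Rightarrow> item \<Rightarrow> item" where
  "item_of_sort n \<equiv> \<lambda>(p, z). ((z - 1) mod n, p + 1)"

text \<open>Being a node of \<open>P\<close>, \<open>u\<close> queries a position below
  \<open>n\<close>; its content on \<open>y\<close> passes the range test, and the selected label is
  the entry of \<open>tagged y\<close>.\<close>

lemma consistent_edge_rank_of_sort:
  assumes "leveled_bp n N P" "y \<in> inputs n (n^2)" "u \<in> nodes P"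
  shows "consistent_edge (rank_of_sort n P) y u =
    map_option (\<lambda>(w, os). (w, map (item_of_sort n) os)) (consistent_edge P (tagged y) u)"
proof (cases "query P u")
  case None
  then show ?thesis by (simp add: consistent_edge_def rank_of_sort_def)
next
  case (Some i)
  then have "i < n" using leveled_query_bound assms by blast
  then show ?thesis
    using Some assms(2) by (simp add: consistent_edge_def rank_of_sort_def inputs_iff nth_tagged)
qed

lemma walk_rank_of_sort:
  assumes "leveled_bp n N P" "y \<in> inputs n (n^2)" "v \<in> nodes P"
  shows "walk (rank_of_sort n P) y v t = walk P (tagged y) v t"
proof (induction t)
  case (Suc t)
  show ?case
  proof (cases "walk P (tagged y) v t")
    case (Some u)
    then have "u \<in> nodes P" using walk_in_nodes[OF assms(1,3)] by blast
    then show ?thesis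
      using Suc Some consistent_edge_rank_of_sort[OF assms(1,2)]
      by (simp add: option.map_comp comp_def split_def)
  qed (use Suc in simp)
qed simp

lemma emitted_rank_of_sort:
  assumes "leveled_bp n N P" "y \<in> inputs n (n^2)" "v \<in> nodes P"
  shows "emitted (rank_of_sort n P) y v t = map (item_of_sort n) (emitted P (tagged y) v t)"
proof (cases "walk P (tagged y) v t")
  case (Some u)
  then have "u \<in> nodes P" using walk_in_nodes[OF assms(1,3)] by blast
  then show ?thesis
    using Some walk_rank_of_sort[OF assms] consistent_edge_rank_of_sort[OF assms(1,2)]
    by (simp add: emitted_def split: option.split)
qed (use walk_rank_of_sort[OF assms] in \<open>simp add: emitted_def\<close>)

lemma outputs_from_rank_of_sort:
  assumes "leveled_bp n N P" "y \<in> inputs n (n^2)" "v \<in> nodes P"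
  shows "outputs_from (rank_of_sort n P) y v = map (item_of_sort n) (outputs_from P (tagged y) v)"
proof -
  have e: "emitted (rank_of_sort n P) y v = (\<lambda>t. map (item_of_sort n) (emitted P (tagged y) v t))"
    using emitted_rank_of_sort[OF assms] by blast
  show ?thesis
    unfolding outputs_from_def rank_of_sort_simps e map_concat map_map comp_def ..
qed

lemma leveled_rank_of_sort:
  assumes "leveled_bp n (n * n^2) P"
  shows "leveled_bp n (n^2) (rank_of_sort n P)"
proof -
  have pair: "pairing n a (Suc i) \<in> {1..n * n^2}" if "i < n" "a \<in> {1..n^2}" for a i
  proof -
    have "(a - 1) * n + n = a * n" using that by (simp add: diff_mult_distrib)
    also have "\<dots> \<le> n * n^2" using that by (simp add: mult.commute)
    finally show ?thesis using that by (simp add: pairing_def)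
  qed
  have edges: "case query P v of
         Some i \<Rightarrow> i < n \<and> out_edge P v None = None \<and>
                   (\<forall>a. out_edge P v (Some a) \<noteq> None \<longleftrightarrow> a \<in> {1..n * n^2})
       | None \<Rightarrow> (\<forall>a. out_edge P v (Some a) = None)" if "v \<in> nodes P" for v
    using assms that unfolding leveled_bp_def by (elim conjE) (rule bspec)
  have new_edges: "case query P v of
         Some i \<Rightarrow> i < n \<and> out_edge (rank_of_sort n P) v None = None \<and>
                   (\<forall>a. out_edge (rank_of_sort n P) v (Some a) \<noteq> None \<longleftrightarrow> a \<in> {1..n^2})
       | None \<Rightarrow> (\<forall>a. out_edge (rank_of_sort n P) v (Some a) = None)" if v: "v \<in> nodes P" for v
  proof (cases "query P v")
    case None
    then show ?thesis using edges[OF v] by (simp add: rank_of_sort_def)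
  next
    case (Some i)
    then have i: "i < n" "out_edge P v None = None"
      "\<And>a. out_edge P v (Some a) \<noteq> None \<longleftrightarrow> a \<in> {1..n * n^2}"
      using edges[OF v] by simp_all
    show ?thesis
      using Some i(1,2) i(3)[of "pairing n _ (Suc i)"] pair[OF i(1)] by (auto simp: rank_of_sort_def)
  qed
  have targets: "w \<in> nodes P \<and> level P w = Suc (level P v)"
    if v: "v \<in> nodes P" and edge: "out_edge (rank_of_sort n P) v l = Some (w, os)" for v l w os
  proof -
    \<comment> \<open>Labels and items change, targets do not.\<close>
    obtain l' os' where "out_edge P v l' = Some (w, os')"
      using edge by (auto simp: rank_of_sort_def split: option.splits if_splits)
    then show ?thesis using assms v unfolding leveled_bp_def by blast
  qed
  have "finite (nodes P)" "start P \<in> nodes P" using assms by (simp_all add: leveled_bp_def)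
  moreover have "\<forall>v\<in>nodes P. level P v = 0 \<longleftrightarrow> v = start P"
    using assms unfolding leveled_bp_def by (elim conjE)
  ultimately show ?thesis
    unfolding leveled_bp_def rank_of_sort_simps by (intro conjI ballI allI impI new_edges) (auto dest: targets)
qed

lemma encoded_rank_of_sort:
  assumes "encoded_bp n (n * n^2) P"
  shows "encoded_bp n (n^2) (rank_of_sort n P)"
proof -
  have lev: "leveled_bp n (n * n^2) P" using assms by (simp add: encoded_bp_def)
  have "outputs_from (rank_of_sort n P) y v = []" if "v \<in> blank P" "y \<in> inputs n (n^2)" for v y
    using that assms tagged_in_inputs[OF that(2)] outputs_from_rank_of_sort[OF lev that(2), of v]
    by (auto simp: encoded_bp_def)
  then show ?thesis
    using assms leveled_rank_of_sort[OF lev] by (simp add: encoded_bp_def)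
qed

lemma ranks_correctly_rank_of_sort:
  assumes lev: "leveled_bp n N P" and y: "y \<in> inputs n (n^2)" and cor: "sorts_correctly P (tagged y)"
  shows "ranks_correctly (rank_of_sort n P) y"
proof -
  let ?s = "sort (tagged y)" and ?f = "item_of_sort n"
  have len: "length y = n" using y by (simp add: inputs_iff)
  have start: "start P \<in> nodes P" using lev by (simp add: leveled_bp_def)
  define os where "os = outputs_from P (tagged y) (start P)"
  have os: "distinct os" "set os = {(p, ?s ! p) |p. p < n}"
    using cor len by (auto simp: sorts_correctly_def produces_def os_def)
  have out: "outputs_from (rank_of_sort n P) y (start P) = map ?f os"
    using outputs_from_rank_of_sort[OF lev y start] by (simp add: os_def)
  have item: "?f (p, ?s ! p) = (i, rank_in y i)" if "i < n" "p < n" "?s ! p = tagged y ! i" for i p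
    using rank_in_sort_tagged[OF y that] that len by (simp add: nth_tagged tag_mod)
  have "?f ` set os = {(i, rank_in y i) |i. i < n}"
  proof (intro equalityI subsetI)
    fix z assume "z \<in> ?f ` set os"
    then obtain p where p: "p < n" "z = ?f (p, ?s ! p)" by (auto simp: os(2))
    then have "?s ! p \<in> set (tagged y)" using nth_mem[of p ?s] len by simp
    then obtain i where "i < n" "?s ! p = tagged y ! i" using len by (auto simp: in_set_conv_nth)
    with item[of i p] p show "z \<in> {(i, rank_in y i) |i. i < n}" by auto
  next
    fix z assume "z \<in> {(i, rank_in y i) |i. i < n}"
    then obtain i where i: "i < n" "z = (i, rank_in y i)" by auto
    then have "tagged y ! i \<in> set ?s" using nth_mem[of i "tagged y"] len by simp
    then obtain p where p: "p < n" "?s ! p = tagged y ! i"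
      unfolding in_set_conv_nth using len by auto
    with item[of i p] i have "z = ?f (p, ?s ! p)" by simp
    with p(1) show "z \<in> ?f ` set os" unfolding os(2) by blast
  qed
  moreover have "inj_on ?f (set os)" unfolding os(2) by (auto simp: inj_on_def)
  ultimately show ?thesis
    using os(1) len by (simp add: ranks_correctly_def produces_def out distinct_map)
qed

lemma costly_rank_of_sort:
  assumes "leveled_bp n N P" "y \<in> inputs n (n^2)"
  shows "costly \<epsilon> n (rank_of_sort n P) y \<longleftrightarrow> costly \<epsilon> n P (tagged y)"
proof -
  have start: "start P \<in> nodes P" using assms(1) by (simp add: leveled_bp_def)
  show ?thesis
    unfolding costly_def last_output_def cum_mem_def node_length_rank_of_sort
    by (simp add: walk_rank_of_sort[OF assms start] emitted_rank_of_sort[OF assms start])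
qed

section \<open>Combining probabilities\<close>

lemma set_pmf_mu_subset: "set_pmf (\<mu> n) \<subseteq> inputs n (n^2)"
proof -
  have "n \<le> n^2" by (simp add: power2_eq_square)
  then have "{1..<Suc n} \<subseteq> {1..n^2}" by (intro subsetI) simp
  \<comment> \<open>\<open>pmf_of_set\<close> needs a nonempty set; the list of 1 to
    \<open>n\<close> is a member even for \<open>n = 0\<close>.\<close>
  then have "[1..<Suc n] \<in> {x \<in> inputs n (n^2). distinct x}"
    by (simp add: inputs_def del: upt_Suc)
  then have "{x \<in> inputs n (n^2). distinct x} \<noteq> {}" by blast
  then have "set_pmf (\<mu> n) = {x \<in> inputs n (n^2). distinct x}"
    unfolding \<mu>_def by (rule set_pmf_of_set) simp
  then show ?thesis by auto
qed

lemma prob_le_add_prob_diff: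
  "measure_pmf.prob M A \<le> measure_pmf.prob M B + measure_pmf.prob M (A - B)"
proof -
  have "measure_pmf.prob M A \<le> measure_pmf.prob M (B \<union> (A - B))"
    by (rule measure_pmf.finite_measure_mono) auto
  also have "\<dots> \<le> measure_pmf.prob M B + measure_pmf.prob M (A - B)"
    by (rule measure_Un_le) auto
  finally show ?thesis .
qed

text \<open>By independence the program may be drawn first and the input afterwards, so a bound
  uniform over fixed programs survives averaging.\<close>

lemma prob_pair_pmf_le:
  assumes "\<And>y. y \<in> set_pmf B \<Longrightarrow> measure_pmf.prob A {x. (x, y) \<in> S} \<le> d" and "d \<ge> 0"
  shows "measure_pmf.prob (pair_pmf A B) S \<le> d"
proof -
  have "pair_pmf A B = bind_pmf B (\<lambda>y. map_pmf (\<lambda>x. (x, y)) A)"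
    unfolding pair_pmf_def map_pmf_def by (rule bind_commute_pmf)
  then have "emeasure (pair_pmf A B) S = (\<integral>\<^sup>+y. emeasure (map_pmf (\<lambda>x. (x, y)) A) S \<partial>measure_pmf B)"
    by (simp only: emeasure_bind_pmf)
  also have "\<dots> \<le> (\<integral>\<^sup>+y. ennreal d \<partial>measure_pmf B)"
  proof (rule nn_integral_mono_AE, rule AE_pmfI)
    fix y assume "y \<in> set_pmf B"
    then have "measure_pmf.prob A {x. (x, y) \<in> S} \<le> d" by (rule assms)
    then show "emeasure (map_pmf (\<lambda>x. (x, y)) A) S \<le> ennreal d"
      by (simp add: measure_pmf.emeasure_eq_measure vimage_def ennreal_leI)
  qed
  also have "\<dots> = ennreal d" by simp
  finally show ?thesis using assms(2) by (simp add: measure_pmf.emeasure_eq_measure)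
qed

theorem proposition2:
  shows
    "(\<comment> \<open>programs correct on every input: ranking, and sorting on tagged inputs\<close>
      \<exists>\<epsilon>>0. \<exists>n0. \<forall>n\<ge>n0.
        (\<forall>P. encoded_bp n (n^2) P \<and> computes_Rank n (n^2) P \<longrightarrow>
           measure_pmf.prob (\<mu> n) {x. costly \<epsilon> n P x} \<ge> 15/16) \<and>
        (\<forall>P. encoded_bp n (n * n^2) P \<and> computes_Sort n (n * n^2) P \<longrightarrow>
           measure_pmf.prob (\<mu> n) {y. costly \<epsilon> n P (tagged y)} \<ge> 15/16)) \<and>
     (\<comment> \<open>correctness with small probability: first without, then with coins\<close>
      \<comment> \<open>(a random program, drawn independently of the input)\<close>
      \<forall>c::real. c \<ge> 0 \<longrightarrow> (\<exists>\<epsilon>>0. \<exists>n0. \<forall>n\<ge>n0.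
        (\<forall>P. encoded_bp n (n^2) P \<and>
             measure_pmf.prob (\<mu> n) {x. ranks_correctly P x} \<ge> real n powr (- c) \<longrightarrow>
           measure_pmf.prob (\<mu> n) {x. costly \<epsilon> n P x} > 15/16 * real n powr (- c)) \<and>
        (\<forall>R :: bprog pmf. (\<forall>P\<in>set_pmf R. encoded_bp n (n^2) P) \<and>
             measure_pmf.prob (pair_pmf (\<mu> n) R) {(x, P). ranks_correctly P x}
               \<ge> real n powr (- c) \<longrightarrow>
           measure_pmf.prob (pair_pmf (\<mu> n) R) {(x, P). costly \<epsilon> n P x}
             > 15/16 * real n powr (- c)))) \<and>
     (\<comment> \<open>the reduction of sorting to ranking\<close>
      \<forall>n P. encoded_bp n (n * n^2) P \<and> computes_Sort n (n * n^2) P \<longrightarrow>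
        encoded_bp n (n^2) (rank_of_sort n P) \<and> computes_Rank n (n^2) (rank_of_sort n P) \<and>
        node_length (rank_of_sort n P) = node_length P \<and>
        (\<forall>y\<in>inputs n (n^2).
           tagged y \<in> inputs n (n * n^2) \<and>
           (\<forall>t. visited (rank_of_sort n P) y t = visited P (tagged y) t) \<and>
           (\<forall>t. length (emitted_at (rank_of_sort n P) y t)
                = length (emitted_at P (tagged y) t)) \<and>
           (\<forall>\<epsilon>. costly \<epsilon> n (rank_of_sort n P) y \<longleftrightarrow> costly \<epsilon> n P (tagged y))))"
proof (intro conjI)
  let ?rare = "\<lambda>c \<epsilon> n. \<forall>P. encoded_bp n (n^2) P \<longrightarrow>
    measure_pmf.prob (\<mu> n) {x. ranks_correctly P x \<and> \<not> costly \<epsilon> n P x} < 1/32 * real n powr (- c)"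
  show "\<exists>\<epsilon>>0. \<exists>n0. \<forall>n\<ge>n0.
        (\<forall>P. encoded_bp n (n^2) P \<and> computes_Rank n (n^2) P \<longrightarrow>
           measure_pmf.prob (\<mu> n) {x. costly \<epsilon> n P x} \<ge> 15/16) \<and>
        (\<forall>P. encoded_bp n (n * n^2) P \<and> computes_Sort n (n * n^2) P \<longrightarrow>
           measure_pmf.prob (\<mu> n) {y. costly \<epsilon> n P (tagged y)} \<ge> 15/16)"
  proof -
    \<comment> \<open>Correctness everywhere is the case \<open>c = 0\<close>: the exceptional set
      has probability below 1/32.\<close>
    obtain \<epsilon> n0 where eps: "\<epsilon> > 0" and rare: "\<And>n. n \<ge> n0 \<Longrightarrow> ?rare 0 \<epsilon> n"
      using prob_correct_not_costly[of 0] by auto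
    have rank: "measure_pmf.prob (\<mu> n) {x. costly \<epsilon> n P x} \<ge> 15/16"
      if n: "n \<ge> max n0 1" and P: "encoded_bp n (n^2) P" and cor: "computes_Rank n (n^2) P" for n P
    proof -
      have "set_pmf (\<mu> n) \<subseteq> {x. ranks_correctly P x}"
        using set_pmf_mu_subset[of n] cor by (auto simp: computes_Rank_def)
      then have "measure_pmf.prob (\<mu> n) {x. ranks_correctly P x} = 1"
        by (simp add: measure_pmf.prob_eq_1 AE_measure_pmf_iff subset_eq)
      moreover have "measure_pmf.prob (\<mu> n) ({x. ranks_correctly P x} - {x. costly \<epsilon> n P x}) < 1/32"
        using rare[of n] n P by (simp add: set_diff_eq)
      ultimately show ?thesis
        using prob_le_add_prob_diff[of "\<mu> n" "{x. ranks_correctly P x}" "{x. costly \<epsilon> n P x}"] by linarith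
    qed
    have sort: "measure_pmf.prob (\<mu> n) {y. costly \<epsilon> n P (tagged y)} \<ge> 15/16"
      if n: "n \<ge> max n0 1" and P: "encoded_bp n (n * n^2) P" and cor: "computes_Sort n (n * n^2) P" for n P
    proof -
      have lev: "leveled_bp n (n * n^2) P" using P by (simp add: encoded_bp_def)
      have "computes_Rank n (n^2) (rank_of_sort n P)"
        using cor ranks_correctly_rank_of_sort[OF lev] tagged_in_inputs
        by (auto simp: computes_Rank_def computes_Sort_def)
      from rank[OF n encoded_rank_of_sort[OF P] this]
      \<comment> \<open>The two cost conditions agree only on inputs, so both events are cut down to
        the support of \<open>\<mu> n\<close>.\<close>
      have "15/16 \<le> measure_pmf.prob (\<mu> n) ({x. costly \<epsilon> n (rank_of_sort n P) x} \<inter> set_pmf (\<mu> n))"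
        by (simp only: measure_Int_set_pmf)
      also have "{x. costly \<epsilon> n (rank_of_sort n P) x} \<inter> set_pmf (\<mu> n) = {y. costly \<epsilon> n P (tagged y)} \<inter> set_pmf (\<mu> n)"
        using set_pmf_mu_subset[of n] costly_rank_of_sort[OF lev] by blast
      finally show ?thesis by (simp only: measure_Int_set_pmf)
    qed
    show ?thesis using eps rank sort by blast
  qed
  show "\<forall>c::real. c \<ge> 0 \<longrightarrow> (\<exists>\<epsilon>>0. \<exists>n0. \<forall>n\<ge>n0.
        (\<forall>P. encoded_bp n (n^2) P \<and>
             measure_pmf.prob (\<mu> n) {x. ranks_correctly P x} \<ge> real n powr (- c) \<longrightarrow>
           measure_pmf.prob (\<mu> n) {x. costly \<epsilon> n P x} > 15/16 * real n powr (- c)) \<and>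
        (\<forall>R :: bprog pmf. (\<forall>P\<in>set_pmf R. encoded_bp n (n^2) P) \<and>
             measure_pmf.prob (pair_pmf (\<mu> n) R) {(x, P). ranks_correctly P x}
               \<ge> real n powr (- c) \<longrightarrow>
           measure_pmf.prob (pair_pmf (\<mu> n) R) {(x, P). costly \<epsilon> n P x}
             > 15/16 * real n powr (- c)))"
  proof (intro allI impI)
    fix c :: real assume "c \<ge> 0"
    then obtain \<epsilon> n0 where eps: "\<epsilon> > 0" and rare: "\<And>n. n \<ge> n0 \<Longrightarrow> ?rare c \<epsilon> n"
      using prob_correct_not_costly[of c] by auto
    have det: "measure_pmf.prob (\<mu> n) {x. costly \<epsilon> n P x} > 15/16 * real n powr (- c)"
      if n: "n \<ge> max n0 1" and P: "encoded_bp n (n^2) P"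
        and cor: "measure_pmf.prob (\<mu> n) {x. ranks_correctly P x} \<ge> real n powr (- c)" for n P
    proof -
      have "measure_pmf.prob (\<mu> n) ({x. ranks_correctly P x} - {x. costly \<epsilon> n P x}) < 1/32 * real n powr (- c)"
        using rare[of n] n P by (simp add: set_diff_eq)
      moreover have "real n powr (- c) > 0" using n by simp
      ultimately show ?thesis
        using cor prob_le_add_prob_diff[of "\<mu> n" "{x. ranks_correctly P x}" "{x. costly \<epsilon> n P x}"] by linarith
    qed
    have coins: "measure_pmf.prob (pair_pmf (\<mu> n) R) {(x, P). costly \<epsilon> n P x} > 15/16 * real n powr (- c)"
      if n: "n \<ge> max n0 1" and R: "\<forall>P\<in>set_pmf R. encoded_bp n (n^2) P"
        and cor: "measure_pmf.prob (pair_pmf (\<mu> n) R) {(x, P). ranks_correctly P x} \<ge> real n powr (- c)"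
      for n and R :: "bprog pmf"
    proof -
      have "measure_pmf.prob (pair_pmf (\<mu> n) R) ({(x, P). ranks_correctly P x} - {(x, P). costly \<epsilon> n P x})
          \<le> 1/32 * real n powr (- c)"
      proof (rule prob_pair_pmf_le)
        fix P assume "P \<in> set_pmf R"
        then show "measure_pmf.prob (\<mu> n) {x. (x, P) \<in> {(x, P). ranks_correctly P x} - {(x, P). costly \<epsilon> n P x}}
            \<le> 1/32 * real n powr (- c)"
          using rare[of n] n R by (simp add: less_imp_le)
      qed simp
      \<comment> \<open>Averaging leaves only a weak inequality; \<open>31/32 > 15/16\<close> and a
        positive factor make the conclusion strict.\<close>
      moreover have "real n powr (- c) > 0" using n by simp
      ultimately show ?thesis
        using cor prob_le_add_prob_diff[of "pair_pmf (\<mu> n) R" "{(x, P). ranks_correctly P x}"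
            "{(x, P). costly \<epsilon> n P x}"] by linarith
    qed
    show "\<exists>\<epsilon>>0. \<exists>n0. \<forall>n\<ge>n0.
        (\<forall>P. encoded_bp n (n^2) P \<and>
             measure_pmf.prob (\<mu> n) {x. ranks_correctly P x} \<ge> real n powr (- c) \<longrightarrow>
           measure_pmf.prob (\<mu> n) {x. costly \<epsilon> n P x} > 15/16 * real n powr (- c)) \<and>
        (\<forall>R :: bprog pmf. (\<forall>P\<in>set_pmf R. encoded_bp n (n^2) P) \<and>
             measure_pmf.prob (pair_pmf (\<mu> n) R) {(x, P). ranks_correctly P x}
               \<ge> real n powr (- c) \<longrightarrow>
           measure_pmf.prob (pair_pmf (\<mu> n) R) {(x, P). costly \<epsilon> n P x}
             > 15/16 * real n powr (- c))"
      using eps det coins by blast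
  qed
  show "\<forall>n P. encoded_bp n (n * n^2) P \<and> computes_Sort n (n * n^2) P \<longrightarrow>
        encoded_bp n (n^2) (rank_of_sort n P) \<and> computes_Rank n (n^2) (rank_of_sort n P) \<and>
        node_length (rank_of_sort n P) = node_length P \<and>
        (\<forall>y\<in>inputs n (n^2).
           tagged y \<in> inputs n (n * n^2) \<and>
           (\<forall>t. visited (rank_of_sort n P) y t = visited P (tagged y) t) \<and>
           (\<forall>t. length (emitted_at (rank_of_sort n P) y t)
                = length (emitted_at P (tagged y) t)) \<and>
           (\<forall>\<epsilon>. costly \<epsilon> n (rank_of_sort n P) y \<longleftrightarrow> costly \<epsilon> n P (tagged y)))"
  proof (intro allI impI conjI ballI; elim conjE)
    fix n P assume P: "encoded_bp n (n * n^2) P" and cor: "computes_Sort n (n * n^2) P"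
    then have lev: "leveled_bp n (n * n^2) P" by (simp add: encoded_bp_def)
    then have start: "start P \<in> nodes P" by (simp add: leveled_bp_def)
    show "encoded_bp n (n^2) (rank_of_sort n P)" by (rule encoded_rank_of_sort[OF P])
    show "computes_Rank n (n^2) (rank_of_sort n P)"
      using cor ranks_correctly_rank_of_sort[OF lev] tagged_in_inputs
      by (auto simp: computes_Rank_def computes_Sort_def)
    show "node_length (rank_of_sort n P) = node_length P" by simp
    fix y assume y: "y \<in> inputs n (n^2)"
    show "tagged y \<in> inputs n (n * n^2)" by (rule tagged_in_inputs[OF y])
    show "visited (rank_of_sort n P) y t = visited P (tagged y) t" for t
      using walk_rank_of_sort[OF lev y start] by simp
    show "length (emitted_at (rank_of_sort n P) y t) = length (emitted_at P (tagged y) t)" for t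
      using emitted_rank_of_sort[OF lev y start] by simp
    show "costly \<epsilon> n (rank_of_sort n P) y \<longleftrightarrow> costly \<epsilon> n P (tagged y)" for \<epsilon>
      by (rule costly_rank_of_sort[OF lev y])
  qed
qed

end
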